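(* Fix $1<p<\infty$, let $1<q<\infty$ satisfy $\frac1p+\frac1q=1$, and fix an integer $r>1$. Then every infinite dimensional subspace $X\subseteq \ell_p$ has an infinite dimensional subspace $Y\subseteq X$ such that for every $x\in Y$ $$4^{-6}\|x\|_p\le (\log_2 r)^{1/p}\,|x|_{p,r}\le 3\cdot 4^{7}(p+q)\,\|x\|_p .$$
   Context: $\|\cdot\|_p$ is the usual norm on $\ell_p$, $(e_n)$ is the unit vector basis, $c_{00}$ is the space of finitely supported real sequences, and $\langle x,y\rangle=\sum_i x(i)y(i)$. Let $K^{\mathcal M}_{q,r}$ be the smallest subset of $c_{00}$ that contains all vectors $\pm e_n$ ($n\in\mathbb N$) and has the property: whenever $y_1,\dots,y_l\in K^{\mathcal M}_{q,r}$ with $l\le r$ and the supports of $y_i$ are pairwise disjoint, then $r^{-1/q}(y_1+\dots+y_l)\in K^{\mathcal M}_{q,r}$. (One has $K^{\mathcal M}_{q,r}\subseteq B_{\ell_q}$.) The modified Tsirelson-type norm is $|x|_{p,r}=\sup\{\langle x,y\rangle : y\in K^{\mathcal M}_{q,r}\}$ for $x\in\ell_p$; equivalently, on $c_{00}$ it is the unique norm satisfying $|x|_{p,r}=\max\{\|x\|_\infty, r^{-1/q}\sup\sum_{i=1}^r|F_ix|_{p,r}\}$, the supremum over pairwise disjoint $F_1,\dots,F_r\subseteq\mathbb N$, where $Fx$ denotes the restriction of $x$ to $F$. *)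

theory Defs
  imports "HOL-Analysis.Analysis"
begin

definition lp :: "real \<Rightarrow> (nat \<Rightarrow> real) set" where
  "lp p = {x. summable (\<lambda>i. \<bar>x i\<bar> powr p)}"

definition pnorm :: "real \<Rightarrow> (nat \<Rightarrow> real) \<Rightarrow> real" where
  "pnorm p x = (\<Sum>i. \<bar>x i\<bar> powr p) powr (1 / p)"

definition unitvec :: "nat \<Rightarrow> nat \<Rightarrow> real" where
  "unitvec n = (\<lambda>i. if i = n then 1 else 0)"

text \<open>Pairing of x with a finitely supported y.\<close>
definition pairing :: "(nat \<Rightarrow> real) \<Rightarrow> (nat \<Rightarrow> real) \<Rightarrow> real" where
  "pairing x y = (\<Sum>k\<in>{k. y k \<noteq> 0}. x k * y k)"

inductive_set KM :: "real \<Rightarrow> nat \<Rightarrow> (nat \<Rightarrow> real) set" for q :: real and r :: nat where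
  unit_pos: "unitvec n \<in> KM q r"
| unit_neg: "(\<lambda>i. - unitvec n i) \<in> KM q r"
| comb: "\<lbrakk> 1 \<le> length ys; length ys \<le> r; \<forall>y\<in>set ys. y \<in> KM q r;
           \<forall>a<length ys. \<forall>b<length ys. a \<noteq> b \<longrightarrow> (\<forall>k. (ys ! a) k = 0 \<or> (ys ! b) k = 0) \<rbrakk>
         \<Longrightarrow> (\<lambda>i. real r powr (- 1 / q) * (\<Sum>y\<leftarrow>ys. y i)) \<in> KM q r"

text \<open>The modified Tsirelson-type norm |x|_{p,r} (with q the conjugate exponent).\<close>
definition tnorm :: "real \<Rightarrow> nat \<Rightarrow> (nat \<Rightarrow> real) \<Rightarrow> real" where
  "tnorm q r x = Sup {pairing x y | y. y \<in> KM q r}"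

definition closed_subspace_lp :: "real \<Rightarrow> (nat \<Rightarrow> real) set \<Rightarrow> bool" where
  "closed_subspace_lp p X \<longleftrightarrow> X \<subseteq> lp p \<and> (\<lambda>i. 0) \<in> X
     \<and> (\<forall>x\<in>X. \<forall>y\<in>X. (\<lambda>i. x i + y i) \<in> X)
     \<and> (\<forall>c. \<forall>x\<in>X. (\<lambda>i. c * x i) \<in> X)
     \<and> (\<forall>s x. (\<forall>n. s n \<in> X) \<and> x \<in> lp p
          \<and> (\<lambda>n. pnorm p (\<lambda>i. s n i - x i)) \<longlonglongrightarrow> 0 \<longrightarrow> x \<in> X)"

definition lin_indep_fin :: "nat \<Rightarrow> (nat \<Rightarrow> nat \<Rightarrow> real) \<Rightarrow> bool" where
  "lin_indep_fin n vs \<longleftrightarrow>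
     (\<forall>c. (\<forall>j. (\<Sum>i<n. c i * vs i j) = 0) \<longrightarrow> (\<forall>i<n. c i = 0))"

definition infinite_dim :: "(nat \<Rightarrow> real) set \<Rightarrow> bool" where
  "infinite_dim X \<longleftrightarrow> (\<forall>n. \<exists>vs. (\<forall>i<n. vs i \<in> X) \<and> lin_indep_fin n vs)"

end

theory Submission
  imports Defs
begin

text \<open>By Kraft's inequality the norming set consists of the nonzero finitely supported vectors \<open>y\<close> in the
  unit ball of \<open>\<ell>\<^sub>q\<close> for which each \<open>\<bar>y i\<bar> powr q\<close> is zero or a power of \<open>1 / r\<close>. Hence
  \<open>tnorm q r x\<close> is governed by how the mass \<open>\<bar>x i\<bar> powr p\<close> is distributed over the fractional parts of
  its logarithm to base \<open>r\<close>. Divide this circle into \<open>M\<close>, about \<open>log 2 r\<close>, windows of ratio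
  \<open>\<beta> = r powr (1 / M) \<le> 2\<close>. If each window carries a fraction of about \<open>1 / M\<close> of the mass, then a
  functional can exploit just one window fully and the gain from the others decays geometrically,
  so \<open>tnorm q r x\<close> is of order \<open>M powr (- 1 / p) * pnorm p x\<close>.

  Multiplication by a scalar rotates the circle. In \<open>X\<close> one finds normalised almost disjoint blocks,
  and by the pigeonhole principle they may be assumed to have nearly the same distribution over the
  windows; adding scaled copies for all \<open>M\<close> rotations with equal masses gives blocks with a nearly
  uniform distribution. The upper and lower bounds for the windows survive, up to constants,
  multiplication by scalars and summation of disjoint vectors, hence hold on the span of such blocks,
  and the norm estimates extend to its closure.\<close>

section \<open>The spaces \<open>\<ell>\<^sub>p\<close>\<close>

text \<open>Convexity up to the boundary of the half-line: if \<open>a\<close> or \<open>b\<close>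
  vanishes, the claim reduces to \<open>t powr p \<le> t\<close> for \<open>t\<close> in the unit
  interval.\<close>

lemma powr_convex_nonneg:
  fixes a b l p :: real
  assumes "1 \<le> p" "0 \<le> a" "0 \<le> b" "0 \<le> l" "l \<le> 1"
  shows "(l * a + (1 - l) * b) powr p \<le> l * a powr p + (1 - l) * b powr p"
proof -
  have scale: "(t * c) powr p \<le> t * c powr p" if "0 \<le> t" "t \<le> 1" "0 \<le> c" for t c :: real
  proof -
    have "t powr p \<le> t"
      using that powr_mono'[of 1 p t] assms(1) by simp
    then show ?thesis
      using that by (simp add: powr_mult mult_right_mono)
  qed
  consider "a = 0" | "b = 0" | "0 < a" "0 < b"
    using assms by linarith
  then show ?thesis
  proof cases
    case 1
    then show ?thesis using scale[of "1 - l" b] assms by simp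
  next
    case 2
    then show ?thesis using scale[of l a] assms by simp
  next
    case 3
    show ?thesis
      using convex_onD[OF powr_convex[OF assms(1)], of "1 - l" a b] 3 assms by simp
  qed
qed

lemma lp_add:
  assumes "1 \<le> p" "x \<in> lp p" "y \<in> lp p"
  shows "(\<lambda>i. x i + y i) \<in> lp p"
proof -
  have bound: "\<bar>x i + y i\<bar> powr p \<le> 2 powr p * (\<bar>x i\<bar> powr p + \<bar>y i\<bar> powr p)" for i
  proof -
    have "\<bar>x i + y i\<bar> powr p \<le> (2 * max \<bar>x i\<bar> \<bar>y i\<bar>) powr p"
      using assms(1) by (intro powr_mono2) auto
    also have "\<dots> = 2 powr p * max \<bar>x i\<bar> \<bar>y i\<bar> powr p"
      by (simp add: powr_mult)
    also have "\<dots> \<le> 2 powr p * (\<bar>x i\<bar> powr p + \<bar>y i\<bar> powr p)"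
      by (intro mult_left_mono) (auto simp: max_def)
    finally show ?thesis .
  qed
  have "summable (\<lambda>i. 2 powr p * (\<bar>x i\<bar> powr p + \<bar>y i\<bar> powr p))"
    using assms by (intro summable_mult summable_add) (auto simp: lp_def)
  then have "summable (\<lambda>i. \<bar>x i + y i\<bar> powr p)"
    by (rule summable_comparison_test'[where N = 0]) (use bound in auto)
  then show ?thesis
    by (simp add: lp_def)
qed

lemma lp_scale: "x \<in> lp p \<Longrightarrow> (\<lambda>i. c * x i) \<in> lp p"
  by (auto simp: lp_def abs_mult powr_mult intro: summable_mult)

lemma lp_diff:
  assumes "1 \<le> p" "x \<in> lp p" "y \<in> lp p"
  shows "(\<lambda>i. x i - y i) \<in> lp p"
  using lp_add[OF assms(1,2) lp_scale[OF assms(3), of "-1"]] by simp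

lemma lp_sum:
  assumes "1 \<le> p" "\<And>n. n \<in> A \<Longrightarrow> f n \<in> lp p"
  shows "(\<lambda>i. \<Sum>n\<in>A. f n i) \<in> lp p"
  using assms(2)
proof (induction A rule: infinite_finite_induct)
  case (insert n A)
  then show ?case using lp_add[OF assms(1), of "f n"] by simp
qed (auto simp: lp_def)

lemma lp_finite_support:
  assumes "finite {i. x i \<noteq> 0}"
  shows "x \<in> lp p"
  unfolding lp_def using assms
  by (auto intro!: summable_finite[of "{i. x i \<noteq> 0}"])

lemma pnorm_nonneg: "0 \<le> pnorm p x"
  by (simp add: pnorm_def)

lemma pnorm_zero: "pnorm p (\<lambda>_. 0) = 0"
  by (simp add: pnorm_def)

lemma pnorm_powr:
  assumes "0 < p" "x \<in> lp p"
  shows "pnorm p x powr p = (\<Sum>i. \<bar>x i\<bar> powr p)"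
proof -
  have "0 \<le> (\<Sum>i. \<bar>x i\<bar> powr p)"
    using assms by (intro suminf_nonneg) (auto simp: lp_def)
  then show ?thesis
    using assms by (simp add: pnorm_def powr_powr)
qed

lemma pnorm_scale:
  assumes "0 < p" "x \<in> lp p"
  shows "pnorm p (\<lambda>i. c * x i) = \<bar>c\<bar> * pnorm p x"
proof -
  have "(\<Sum>i. \<bar>c * x i\<bar> powr p) = \<bar>c\<bar> powr p * (\<Sum>i. \<bar>x i\<bar> powr p)"
    using assms suminf_mult[of "\<lambda>i. \<bar>x i\<bar> powr p" "\<bar>c\<bar> powr p"]
    by (simp add: lp_def abs_mult powr_mult)
  moreover have "0 \<le> (\<Sum>i. \<bar>x i\<bar> powr p)"
    using assms by (intro suminf_nonneg) (auto simp: lp_def)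
  ultimately show ?thesis
    using assms by (simp add: pnorm_def powr_mult powr_powr)
qed

lemma pnorm_minus_commute: "pnorm p (\<lambda>i. x i - y i) = pnorm p (\<lambda>i. y i - x i)"
  by (simp add: pnorm_def abs_minus_commute)

lemma pnorm_eq_0D:
  assumes "0 < p" "x \<in> lp p" "pnorm p x = 0"
  shows "x i = 0"
proof -
  have "(\<Sum>i. \<bar>x i\<bar> powr p) = 0"
    using pnorm_powr[OF assms(1,2)] assms by simp
  then show ?thesis
    using assms suminf_eq_zero_iff[of "\<lambda>i. \<bar>x i\<bar> powr p"] by (auto simp: lp_def)
qed

lemma pnorm_le:
  assumes "0 < p" "x \<in> lp p" "0 \<le> C" "(\<Sum>i. \<bar>x i\<bar> powr p) \<le> C powr p"
  shows "pnorm p x \<le> C"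
proof -
  have "pnorm p x powr p \<le> C powr p"
    using assms pnorm_powr by simp
  then show ?thesis
    using assms pnorm_nonneg[of p x] powr_less_mono2[of p C "pnorm p x"] by force
qed

text \<open>Minkowski's inequality follows from convexity of the \<open>p\<close>-th power: for
  nonzero norms \<open>A\<close> and \<open>B\<close>,
  \<open>\<bar>x i\<bar> + \<bar>y i\<bar>\<close> is \<open>A + B\<close> times a convex
  combination of the normalised entries, with weights \<open>A / (A + B)\<close> and
  \<open>B / (A + B)\<close>. Vectors of norm zero cannot be normalised, but they vanish.\<close>

lemma pnorm_triangle:
  assumes "1 \<le> p" "x \<in> lp p" "y \<in> lp p"
  shows "pnorm p (\<lambda>i. x i + y i) \<le> pnorm p x + pnorm p y"
proof (cases "pnorm p x = 0 \<or> pnorm p y = 0")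
  case True
  then show ?thesis
    using pnorm_eq_0D[of p x] pnorm_eq_0D[of p y] assms pnorm_nonneg[of p] by auto
next
  case False
  define A B where "A = pnorm p x" and "B = pnorm p y"
  have pos: "0 < A" "0 < B"
    using False pnorm_nonneg[of p x] pnorm_nonneg[of p y] by (auto simp: A_def B_def less_le)
  define l where "l = A / (A + B)"
  have l: "0 \<le> l" "l \<le> 1" "1 - l = B / (A + B)"
    using pos by (auto simp: l_def field_simps)
  define f where "f i = (A + B) powr p * (l * (\<bar>x i\<bar> powr p / A powr p)
      + (1 - l) * (\<bar>y i\<bar> powr p / B powr p))" for i
  have bound: "\<bar>x i + y i\<bar> powr p \<le> f i" for i
  proof -
    have eq: "\<bar>x i\<bar> + \<bar>y i\<bar> = (A + B) * (l * (\<bar>x i\<bar> / A) + (1 - l) * (\<bar>y i\<bar> / B))"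
      unfolding l(3) using pos by (simp add: l_def distrib_left)
    have "\<bar>x i + y i\<bar> powr p \<le> (\<bar>x i\<bar> + \<bar>y i\<bar>) powr p"
      using assms by (intro powr_mono2) auto
    also have "\<dots> = (A + B) powr p * (l * (\<bar>x i\<bar> / A) + (1 - l) * (\<bar>y i\<bar> / B)) powr p"
      unfolding eq using pos l by (subst powr_mult) auto
    also have "\<dots> \<le> (A + B) powr p *
        (l * (\<bar>x i\<bar> / A) powr p + (1 - l) * (\<bar>y i\<bar> / B) powr p)"
      using assms pos l by (intro mult_left_mono powr_convex_nonneg) auto
    also have "\<dots> = f i"
      using pos by (simp add: f_def powr_divide)
    finally show ?thesis .
  qed
  have "(\<lambda>i. \<bar>x i\<bar> powr p) sums (A powr p)" "(\<lambda>i. \<bar>y i\<bar> powr p) sums (B powr p)"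
    using assms pnorm_powr[of p x] pnorm_powr[of p y] by (auto simp: lp_def A_def B_def)
  then have "f sums ((A + B) powr p * (l * (A powr p / A powr p) + (1 - l) * (B powr p / B powr p)))"
    unfolding f_def by (intro sums_mult sums_add sums_divide)
  then have fs: "f sums ((A + B) powr p)"
    using pos by simp
  have "(\<Sum>i. \<bar>x i + y i\<bar> powr p) \<le> (A + B) powr p"
    using fs lp_add[OF assms] bound suminf_le[of "\<lambda>i. \<bar>x i + y i\<bar> powr p" f]
    by (auto simp: sums_iff lp_def)
  then show ?thesis
    using assms lp_add[OF assms] pos by (intro pnorm_le) (auto simp: A_def B_def)
qed

lemma pnorm_triangle_diff:
  assumes "1 \<le> p" "x \<in> lp p" "y \<in> lp p"
  shows "pnorm p x \<le> pnorm p y + pnorm p (\<lambda>i. x i - y i)"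
  using pnorm_triangle[OF assms(1,3) lp_diff[OF assms]] by simp

lemma pnorm_sum:
  assumes "1 \<le> p" "\<And>n. n \<in> A \<Longrightarrow> f n \<in> lp p"
  shows "pnorm p (\<lambda>i. \<Sum>n\<in>A. f n i) \<le> (\<Sum>n\<in>A. pnorm p (f n))"
  using assms(2)
proof (induction A rule: infinite_finite_induct)
  case (insert n A)
  have "pnorm p (\<lambda>i. f n i + (\<Sum>m\<in>A. f m i)) \<le> pnorm p (f n) + pnorm p (\<lambda>i. \<Sum>m\<in>A. f m i)"
    using insert assms(1) by (intro pnorm_triangle lp_sum) auto
  then show ?case using insert by simp
qed (auto simp: pnorm_def)

lemma pnorm_finite_support:
  assumes "finite A" "\<And>i. i \<notin> A \<Longrightarrow> x i = 0"
  shows "pnorm p x = (\<Sum>i\<in>A. \<bar>x i\<bar> powr p) powr (1 / p)"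
  unfolding pnorm_def using assms by (subst suminf_finite[of A]) auto

section \<open>Kraft's inequality and the norming set\<close>

text \<open>Disjointly supported vectors contribute at most one nonzero summand to each coordinate,
  so powers and window functions pass through the sum. For infinite \<open>A\<close> both sums are
  zero by convention.\<close>

lemma sum_at_most_one_nonzero:
  fixes f :: "'a \<Rightarrow> 'b::comm_monoid_add" and \<phi> :: "'b \<Rightarrow> 'c::comm_monoid_add"
  assumes "\<phi> 0 = 0"
    and "\<And>m n. m \<in> A \<Longrightarrow> n \<in> A \<Longrightarrow> m \<noteq> n \<Longrightarrow> f m = 0 \<or> f n = 0"
  shows "\<phi> (\<Sum>n\<in>A. f n) = (\<Sum>n\<in>A. \<phi> (f n))"
proof (cases "\<exists>n\<in>A. f n \<noteq> 0")
  case True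
  then obtain n where n: "n \<in> A" "f n \<noteq> 0" by blast
  then have z: "m \<in> A - {n} \<Longrightarrow> f m = 0" for m
    using assms(2) by blast
  show ?thesis
  proof (cases "finite A")
    case True
    then show ?thesis
      using n z assms(1) by (simp add: sum.remove[of A n])
  qed (simp add: assms)
qed (simp add: assms)

lemma KM_comb_sum:
  assumes "\<And>a. a < l \<Longrightarrow> Y a \<in> KM q r" "1 \<le> l" "l \<le> r"
    and "\<And>a b k. a < l \<Longrightarrow> b < l \<Longrightarrow> a \<noteq> b \<Longrightarrow> Y a k = 0 \<or> Y b k = 0"
  shows "(\<lambda>i. real r powr (- 1 / q) * (\<Sum>a<l. Y a i)) \<in> KM q r"
  using KM.comb[of "map Y [0..<l]" r q] assms
  by (simp add: comp_def interv_sum_list_conv_sum_set_nat atLeast0LessThan)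

text \<open>Necessary conditions for membership in \<open>KM q r\<close>; the exponent 0 accounts
  for the unit vectors. The zero vector meets them although it is not in
  \<open>KM q r\<close>.\<close>

definition grid_vector :: "real \<Rightarrow> nat \<Rightarrow> (nat \<Rightarrow> real) \<Rightarrow> bool" where
  "grid_vector q r y \<longleftrightarrow> finite {i. y i \<noteq> 0} \<and>
     (\<forall>i. y i \<noteq> 0 \<longrightarrow> (\<exists>k::nat. \<bar>y i\<bar> powr q = 1 / real r ^ k)) \<and>
     (\<Sum>i | y i \<noteq> 0. \<bar>y i\<bar> powr q) \<le> 1"

text \<open>A combination step multiplies every \<open>q\<close>-th power by \<open>1 / r\<close>,
  which raises each exponent by one. At most \<open>r\<close> sums bounded by 1 are added and
  divided by \<open>r\<close>, so Kraft's bound persists.\<close>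

lemma KM_imp_grid_vector:
  assumes "0 < q" "0 < r" "y \<in> KM q r"
  shows "grid_vector q r y"
  using assms(3)
proof induction
  case (unit_pos n)
  have "{i. unitvec n i \<noteq> 0} = {n}" by (auto simp: unitvec_def)
  then show ?case by (auto simp: grid_vector_def unitvec_def intro: exI[of _ 0])
next
  case (unit_neg n)
  have "{i. - unitvec n i \<noteq> 0} = {n}" by (auto simp: unitvec_def)
  then show ?case by (auto simp: grid_vector_def unitvec_def intro: exI[of _ 0])
next
  case (comb ys)
  define l where "l = length ys"
  define c where "c = real r powr (- 1 / q)"
  define z where "z i = c * (\<Sum>y\<leftarrow>ys. y i)" for i
  have c: "0 < c" "c powr q = 1 / real r"
    using assms by (simp_all add: c_def powr_powr powr_neg_one)
  have z_sum: "z i = c * (\<Sum>a<l. (ys ! a) i)" for i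
    by (simp add: z_def sum_list_sum_nth l_def atLeast0LessThan)
  have disj: "(ys ! a) i = 0 \<or> (ys ! b) i = 0" if "a \<in> {..<l}" "b \<in> {..<l}" "a \<noteq> b" for a b i
    using comb that by (auto simp: l_def)
  have grid: "grid_vector q r (ys ! a)" if "a < l" for a
    using comb that by (auto simp: l_def)
  define F where "F = (\<Union>a<l. {i. (ys ! a) i \<noteq> 0})"
  have F: "finite F"
    using grid by (auto simp: F_def grid_vector_def)
  have supp: "{i. z i \<noteq> 0} \<subseteq> F"
    by (force simp: z_sum F_def dest: sum.not_neutral_contains_not_neutral)
  have z_powr: "\<bar>z i\<bar> powr q = (\<Sum>a<l. \<bar>(ys ! a) i\<bar> powr q) / real r" for i
  proof -
    have "\<bar>z i\<bar> powr q = \<bar>\<Sum>a<l. (ys ! a) i\<bar> powr q / real r"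
      using c by (simp add: z_sum abs_mult powr_mult)
    also have "\<bar>\<Sum>a<l. (ys ! a) i\<bar> powr q = (\<Sum>a<l. \<bar>(ys ! a) i\<bar> powr q)"
      using disj by (intro sum_at_most_one_nonzero[where \<phi> = "\<lambda>t. \<bar>t\<bar> powr q"]) auto
    finally show ?thesis .
  qed
  have "\<exists>k::nat. \<bar>z i\<bar> powr q = 1 / real r ^ k" if nz: "z i \<noteq> 0" for i
  proof -
    from nz obtain a where a: "a < l" "(ys ! a) i \<noteq> 0"
      using supp by (auto simp: F_def)
    then obtain k :: nat where k: "\<bar>(ys ! a) i\<bar> powr q = 1 / real r ^ k"
      using grid by (auto simp: grid_vector_def)
    have "(\<Sum>b<l. \<bar>(ys ! b) i\<bar> powr q) = \<bar>(ys ! a) i\<bar> powr q"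
      using a disj[of _ a i] by (subst sum.remove[of _ a]) (auto intro!: sum.neutral)
    then have "\<bar>z i\<bar> powr q = 1 / real r ^ Suc k"
      using k by (simp add: z_powr)
    then show ?thesis by blast
  qed
  moreover have "(\<Sum>i | z i \<noteq> 0. \<bar>z i\<bar> powr q) \<le> 1"
  proof -
    have "(\<Sum>i | z i \<noteq> 0. \<bar>z i\<bar> powr q) = (\<Sum>i\<in>F. \<bar>z i\<bar> powr q)"
      using F supp by (intro sum.mono_neutral_left) auto
    also have "\<dots> = (\<Sum>a<l. \<Sum>i\<in>F. \<bar>(ys ! a) i\<bar> powr q) / real r"
      unfolding z_powr sum_divide_distrib[symmetric] by (simp add: sum.swap[of _ _ F])
    also have "(\<Sum>a<l. \<Sum>i\<in>F. \<bar>(ys ! a) i\<bar> powr q)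
        = (\<Sum>a<l. \<Sum>i | (ys ! a) i \<noteq> 0. \<bar>(ys ! a) i\<bar> powr q)"
      using F by (intro sum.cong refl sum.mono_neutral_right) (auto simp: F_def)
    also have "\<dots> \<le> (\<Sum>a<l. 1)"
      using grid by (intro sum_mono) (auto simp: grid_vector_def)
    also have "\<dots> \<le> real r"
      using comb by (simp add: l_def)
    finally show ?thesis
      using assms by (simp add: divide_simps)
  qed
  ultimately have "grid_vector q r z"
    using finite_subset[OF supp F] by (simp add: grid_vector_def)
  then show ?case
    by (simp add: z_def[abs_def] c_def)
qed

text \<open>The item with the largest exponent is inserted last: the load of a bin that is not
  full is then at most one minus the size of that item, as both are multiples of this size.\<close>

lemma kraft_bins:
  fixes k :: "'a \<Rightarrow> nat" and r n :: nat
  assumes "0 < r" "finite F" "(\<Sum>i\<in>F. 1 / real r ^ k i) \<le> real n"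
  shows "\<exists>g. (\<forall>i\<in>F. g i < n) \<and> (\<forall>j<n. (\<Sum>i | i \<in> F \<and> g i = j. 1 / real r ^ k i) \<le> 1)"
  using assms(2,3)
proof (induction "card F" arbitrary: F)
  case 0
  then show ?case by simp
next
  case (Suc c)
  then have F: "finite F" "F \<noteq> {}" by auto
  define K where "K = Max (k ` F)"
  have "K \<in> k ` F" using F by (auto simp: K_def)
  then obtain m where m: "m \<in> F" "k m = K" by auto
  have K: "k i \<le> K" if "i \<in> F" for i
    using F that by (simp add: K_def)
  let ?F = "F - {m}"
  have split: "(\<Sum>i\<in>F. 1 / real r ^ k i) = 1 / real r ^ K + (\<Sum>i\<in>?F. 1 / real r ^ k i)"
    using F m by (simp add: sum.remove)
  have K_pos: "0 < 1 / real r ^ K"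
    using assms(1) by simp
  have "\<exists>g. (\<forall>i\<in>?F. g i < n) \<and> (\<forall>j<n. (\<Sum>i | i \<in> ?F \<and> g i = j. 1 / real r ^ k i) \<le> 1)"
  proof (rule Suc.hyps(1))
    show "(\<Sum>i\<in>?F. 1 / real r ^ k i) \<le> real n"
      using Suc.prems(2) split K_pos by linarith
  qed (use Suc.hyps(2) m F in auto)
  then obtain g where g: "\<And>i. i \<in> ?F \<Longrightarrow> g i < n"
    and load: "\<And>j. j < n \<Longrightarrow> (\<Sum>i | i \<in> ?F \<and> g i = j. 1 / real r ^ k i) \<le> 1"
    by blast
  define L where "L j = (\<Sum>i | i \<in> ?F \<and> g i = j. 1 / real r ^ k i)" for j
  have "(\<Sum>j<n. L j) = (\<Sum>i\<in>?F. 1 / real r ^ k i)"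
    unfolding L_def using F g by (intro sum.group) auto
  also have "\<dots> < real n"
    using split Suc.prems K_pos by linarith
  finally have "\<exists>j<n. L j < 1"
    by (metis (no_types, lifting) not_less sum_bounded_below[of "{..<n}" 1 L] lessThan_iff
        card_lessThan mult.right_neutral)
  then obtain j where j: "j < n" "L j < 1" by blast
  define w where "w = (\<Sum>i | i \<in> ?F \<and> g i = j. r ^ (K - k i))"
  have L_nat: "L j = real w / real r ^ K"
    unfolding L_def w_def of_nat_sum sum_divide_distrib
  proof (rule sum.cong)
    fix i assume "i \<in> {i. i \<in> ?F \<and> g i = j}"
    then have "real r ^ (K - k i) * real r ^ k i = real r ^ K"
      using K by (simp add: power_add[symmetric])
    then show "1 / real r ^ k i = real (r ^ (K - k i)) / real r ^ K"
      using assms(1) by (simp add: divide_simps)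
  qed simp
  have "real w < real r ^ K"
    using j(2)[unfolded L_nat] assms(1) by (subst (asm) divide_less_eq_1_pos) auto
  then have "w + 1 \<le> r ^ K"
    by (metis Suc_eq_plus1 Suc_leI of_nat_less_iff of_nat_power)
  then have "real w + 1 \<le> real r ^ K"
    by (metis of_nat_1 of_nat_add of_nat_le_iff of_nat_power)
  then have room: "L j + 1 / real r ^ K \<le> 1"
    using assms(1) unfolding L_nat by (simp add: divide_simps)
  define g' where "g' = g(m := j)"
  have "(\<Sum>i | i \<in> F \<and> g' i = j'. 1 / real r ^ k i) \<le> 1" if j': "j' < n" for j'
  proof (cases "j' = j")
    case True
    then have "{i. i \<in> F \<and> g' i = j'} = insert m {i. i \<in> ?F \<and> g i = j}"
      using m by (auto simp: g'_def)
    then show ?thesis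
      using room F m by (simp add: L_def)
  next
    case False
    then have "{i. i \<in> F \<and> g' i = j'} = {i. i \<in> ?F \<and> g i = j'}"
      by (auto simp: g'_def)
    then show ?thesis using load[OF j'] by simp
  qed
  moreover have "\<forall>i\<in>F. g' i < n"
    using g j by (auto simp: g'_def)
  ultimately show ?case by blast
qed

text \<open>Converse to \<open>KM_imp_grid_vector\<close>, by induction on a bound for the
  exponents. An exponent 0 exhausts the Kraft sum and leaves a signed unit vector. Otherwise all
  exponents drop by one, the Kraft sum becomes at most \<open>r\<close>, and
  \<open>kraft_bins\<close> distributes it over \<open>r\<close> bins that one combination step
  joins.\<close>

lemma kraft_vector_in_KM:
  fixes k :: "nat \<Rightarrow> nat" and \<sigma> :: "nat \<Rightarrow> real"
  assumes "0 < r" "finite F" "F \<noteq> {}" "(\<Sum>i\<in>F. 1 / real r ^ k i) \<le> 1"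
    and "\<And>i. i \<in> F \<Longrightarrow> \<bar>\<sigma> i\<bar> = 1"
  shows "(\<lambda>i. if i \<in> F then \<sigma> i * real r powr (- real (k i) / q) else 0) \<in> KM q r"
proof -
  have "\<forall>i\<in>F. k i < m \<Longrightarrow> ?thesis" for m
    using assms(2-5)
  proof (induction m arbitrary: F k)
    case 0
    then show ?case by auto
  next
    case (Suc m)
    show ?case
    proof (cases "\<exists>i\<in>F. k i = 0")
      case True
      then obtain i where i: "i \<in> F" "k i = 0" by blast
      have "(\<Sum>i\<in>F - {i}. 1 / real r ^ k i) \<le> 0"
        using Suc.prems i by (simp add: sum.remove)
      then have "F - {i} = {}"
        using Suc.prems(2) assms(1) sum_pos[of "F - {i}" "\<lambda>i. 1 / real r ^ k i"] by fastforce
      then have "F = {i}"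
        using i by blast
      moreover have "\<sigma> i = 1 \<or> \<sigma> i = - 1"
        using Suc.prems(5)[OF i(1)] by linarith
      ultimately have "(\<lambda>i. if i \<in> F then \<sigma> i * real r powr (- real (k i) / q) else 0)
          \<in> {unitvec i, \<lambda>n. - unitvec i n}"
        using i assms(1) by (auto simp: unitvec_def fun_eq_iff)
      then show ?thesis
        using KM.unit_pos[of i q r] KM.unit_neg[of i q r] by auto
    next
      case False
      define k' where "k' i = k i - 1" for i
      have k': "k i = Suc (k' i)" "k' i < m" if "i \<in> F" for i
      proof -
        have "0 < k i" "k i < Suc m"
          using False Suc.prems(1) that by auto
        then show "k i = Suc (k' i)" "k' i < m"
          unfolding k'_def by linarith+
      qed
      have "(\<Sum>i\<in>F. 1 / real r ^ k' i) = real r * (\<Sum>i\<in>F. 1 / real r ^ k i)"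
        unfolding sum_distrib_left using k' assms(1) by (intro sum.cong) auto
      also have "\<dots> \<le> real r"
        using Suc.prems assms(1) by (simp add: mult_left_le)
      finally obtain g where g: "\<And>i. i \<in> F \<Longrightarrow> g i < r"
        and load: "\<And>j. j < r \<Longrightarrow> (\<Sum>i | i \<in> F \<and> g i = j. 1 / real r ^ k' i) \<le> 1"
        using kraft_bins[OF assms(1) Suc.prems(2), of k' r] by blast
      define G where "G j = {i \<in> F. g i = j}" for j
      define v where "v j = (\<lambda>i. if i \<in> G j then \<sigma> i * real r powr (- real (k' i) / q) else 0)" for j
      have v_KM: "v j \<in> KM q r" if "j \<in> g ` F" for j
        unfolding v_def
      proof (rule Suc.IH)
        show "finite (G j)" "G j \<noteq> {}" "\<forall>i\<in>G j. k' i < m" "\<And>i. i \<in> G j \<Longrightarrow> \<bar>\<sigma> i\<bar> = 1"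
          using that Suc.prems k' by (auto simp: G_def)
        show "(\<Sum>i\<in>G j. 1 / real r ^ k' i) \<le> 1"
          using load[of j] that g by (auto simp: G_def)
      qed
      \<comment> \<open>An empty bin would give the zero vector, so only the \<open>l\<close>
        occupied bins enter the combination.\<close>
      define l where "l = card (g ` F)"
      obtain e where e: "bij_betw e {..<l} (g ` F)"
        using ex_bij_betw_nat_finite[of "g ` F"] Suc.prems(2) by (auto simp: l_def atLeast0LessThan)
      have "l \<le> r"
        using g card_mono[of "{..<r}" "g ` F"] by (auto simp: l_def)
      moreover have "1 \<le> l"
        using Suc.prems by (simp add: l_def Suc_le_eq card_gt_0_iff)
      moreover have "v (e a) \<in> KM q r" if "a < l" for a
        using v_KM bij_betwE[OF e] that by blast
      moreover have "v (e a) i = 0 \<or> v (e b) i = 0" if "a < l" "b < l" "a \<noteq> b" for a b i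
        using that e by (auto simp: v_def G_def bij_betw_def inj_on_def)
      ultimately have "(\<lambda>i. real r powr (- 1 / q) * (\<Sum>a<l. v (e a) i)) \<in> KM q r"
        by (intro KM_comb_sum) auto
      moreover have "real r powr (- 1 / q) * (\<Sum>a<l. v (e a) i)
          = (if i \<in> F then \<sigma> i * real r powr (- real (k i) / q) else 0)" for i
      proof -
        have "(\<Sum>a<l. v (e a) i) = (\<Sum>j\<in>g ` F. v j i)"
          by (rule sum.reindex_bij_betw[OF e])
        also have "\<dots> = (\<Sum>j\<in>g ` F. if g i = j then
            (if i \<in> F then \<sigma> i * real r powr (- real (k' i) / q) else 0) else 0)"
          by (intro sum.cong) (auto simp: v_def G_def)
        also have "\<dots> = (if i \<in> F then \<sigma> i * real r powr (- real (k' i) / q) else 0)"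
          using Suc.prems(2) by (subst sum.delta') auto
        finally show ?thesis
          using assms(1) k'(1)[of i]
          by (auto simp: powr_add[symmetric] diff_divide_distrib add_divide_distrib)
      qed
      ultimately show ?thesis by simp
    qed
  qed
  moreover have "\<forall>i\<in>F. k i < Suc (Max (k ` F))"
    using assms(2) by (simp add: less_Suc_eq_le)
  ultimately show ?thesis by blast
qed

section \<open>Hoelder's inequality and perturbation of the norm\<close>

lemma pairing_le_pnorm:
  assumes "1 < p" "1 < q" "1 / p + 1 / q = 1" "0 < r" "x \<in> lp p" "y \<in> KM q r"
  shows "pairing x y \<le> pnorm p x"
proof (cases "pnorm p x = 0")
  case True
  then show ?thesis
    using pnorm_eq_0D[of p x] assms by (simp add: pairing_def)
next
  case False
  define S where "S = pnorm p x"
  have S: "0 < S"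
    using False pnorm_nonneg[of p x] by (simp add: S_def)
  define A where "A = {i. y i \<noteq> 0}"
  have y: "finite A" "(\<Sum>i\<in>A. \<bar>y i\<bar> powr q) \<le> 1"
    using KM_imp_grid_vector[of q r y] assms by (auto simp: grid_vector_def A_def)
  have "(\<Sum>i\<in>A. \<bar>x i\<bar> powr p) \<le> (\<Sum>i. \<bar>x i\<bar> powr p)"
    using assms y by (intro sum_le_suminf) (auto simp: lp_def)
  also have "\<dots> = S powr p"
    using pnorm_powr[of p x] assms by (simp add: S_def)
  finally have x: "(\<Sum>i\<in>A. (\<bar>x i\<bar> / S) powr p) \<le> 1"
    using S by (simp add: powr_divide sum_divide_distrib[symmetric] divide_le_eq)
  \<comment> \<open>Young's inequality is applied to \<open>x\<close> divided by its norm: both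
    power sums are then at most 1, and the weights \<open>1 / p\<close> and \<open>1 / q\<close> add
    up to 1.\<close>
  have "(\<Sum>i\<in>A. x i * y i) \<le> (\<Sum>i\<in>A. S * ((\<bar>x i\<bar> / S) powr p / p + \<bar>y i\<bar> powr q / q))"
  proof (rule sum_mono)
    fix i
    have "x i * y i \<le> \<bar>x i\<bar> * \<bar>y i\<bar>"
      by (simp add: abs_mult[symmetric])
    also have "\<dots> = S * (\<bar>x i\<bar> / S * \<bar>y i\<bar>)"
      using S by simp
    also have "\<dots> \<le> S * ((\<bar>x i\<bar> / S) powr p / p + \<bar>y i\<bar> powr q / q)"
      using S assms by (intro mult_left_mono Youngs_inequality) auto
    finally show "x i * y i \<le> S * ((\<bar>x i\<bar> / S) powr p / p + \<bar>y i\<bar> powr q / q)" .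
  qed
  also have "\<dots> = S * ((\<Sum>i\<in>A. (\<bar>x i\<bar> / S) powr p) / p + (\<Sum>i\<in>A. \<bar>y i\<bar> powr q) / q)"
    by (simp add: sum_distrib_left[symmetric] sum.distrib sum_divide_distrib)
  also have "\<dots> \<le> S * (1 / p + 1 / q)"
    using S x y assms by (intro mult_left_mono add_mono divide_right_mono) auto
  finally show ?thesis
    using assms by (simp add: pairing_def A_def S_def)
qed

lemma pairing_le_tnorm:
  assumes "1 < p" "1 < q" "1 / p + 1 / q = 1" "0 < r" "x \<in> lp p" "y \<in> KM q r"
  shows "pairing x y \<le> tnorm q r x"
  unfolding tnorm_def using assms pairing_le_pnorm[OF assms(1-5)]
  by (intro cSup_upper bdd_aboveI[of _ "pnorm p x"]) auto

lemma tnorm_leI: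
  assumes "\<And>y. y \<in> KM q r \<Longrightarrow> pairing x y \<le> C"
  shows "tnorm q r x \<le> C"
  unfolding tnorm_def using assms KM.unit_pos[of 0 q r] by (intro cSup_least) auto

text \<open>Every member of \<open>KM q r\<close> acts on \<open>lp p\<close> with norm at most 1.
  This transfers estimates from exact blocks to nearby vectors of the subspace.\<close>

lemma tnorm_perturb:
  assumes "1 < p" "1 < q" "1 / p + 1 / q = 1" "0 < r" "x \<in> lp p" "z \<in> lp p"
  shows "tnorm q r x \<le> tnorm q r z + pnorm p (\<lambda>i. x i - z i)"
proof (rule tnorm_leI)
  fix y assume y: "y \<in> KM q r"
  have "pairing x y = pairing z y + pairing (\<lambda>i. x i - z i) y"
    by (simp add: pairing_def sum.distrib[symmetric] algebra_simps)
  also have "\<dots> \<le> tnorm q r z + pnorm p (\<lambda>i. x i - z i)"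
    using assms y by (intro add_mono pairing_le_tnorm pairing_le_pnorm lp_diff) auto
  finally show "pairing x y \<le> tnorm q r z + pnorm p (\<lambda>i. x i - z i)" .
qed

section \<open>Logarithmic windows\<close>

text \<open>One scheme for the whole mass and for the mass in a window, so that additivity over
  disjoint supports is proved once for both.\<close>

definition total :: "(real \<Rightarrow> real) \<Rightarrow> (nat \<Rightarrow> real) \<Rightarrow> real" where
  "total \<phi> z = (\<Sum>i | z i \<noteq> 0. \<phi> (z i))"

lemma total_superset:
  assumes "\<phi> 0 = 0" "finite A" "\<And>i. i \<notin> A \<Longrightarrow> z i = 0"
  shows "total \<phi> z = (\<Sum>i\<in>A. \<phi> (z i))"
  unfolding total_def using assms by (intro sum.mono_neutral_left) auto

lemma finite_support_sum:
  fixes f :: "'a \<Rightarrow> nat \<Rightarrow> real"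
  assumes "finite A" "\<And>n. n \<in> A \<Longrightarrow> finite {i. f n i \<noteq> 0}"
  shows "finite {i. (\<Sum>n\<in>A. f n i) \<noteq> 0}"
proof (rule finite_subset)
  show "{i. (\<Sum>n\<in>A. f n i) \<noteq> 0} \<subseteq> (\<Union>n\<in>A. {i. f n i \<noteq> 0})"
    by (auto dest: sum.not_neutral_contains_not_neutral)
qed (use assms in auto)

lemma total_sum_disjoint:
  fixes f :: "'a \<Rightarrow> nat \<Rightarrow> real"
  assumes "\<phi> 0 = 0" "finite A" "\<And>n. n \<in> A \<Longrightarrow> finite {i. f n i \<noteq> 0}"
    and "\<And>m n i. m \<in> A \<Longrightarrow> n \<in> A \<Longrightarrow> m \<noteq> n \<Longrightarrow> f m i = 0 \<or> f n i = 0"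
  shows "total \<phi> (\<lambda>i. \<Sum>n\<in>A. f n i) = (\<Sum>n\<in>A. total \<phi> (f n))"
proof -
  define S where "S = (\<Union>n\<in>A. {i. f n i \<noteq> 0})"
  have S: "finite S" using assms by (auto simp: S_def)
  have "total \<phi> (\<lambda>i. \<Sum>n\<in>A. f n i) = (\<Sum>i\<in>S. \<phi> (\<Sum>n\<in>A. f n i))"
    using S assms(1) by (intro total_superset) (auto simp: S_def)
  also have "\<dots> = (\<Sum>i\<in>S. \<Sum>n\<in>A. \<phi> (f n i))"
    using assms by (intro sum.cong sum_at_most_one_nonzero) auto
  also have "\<dots> = (\<Sum>n\<in>A. \<Sum>i\<in>S. \<phi> (f n i))"
    by (rule sum.swap)
  also have "\<dots> = (\<Sum>n\<in>A. total \<phi> (f n))"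
    using S assms(1) by (intro sum.cong refl total_superset[symmetric]) (auto simp: S_def)
  finally show ?thesis .
qed

lemma total_mono:
  assumes "\<And>t. t \<noteq> 0 \<Longrightarrow> \<phi> t \<le> \<psi> t"
  shows "total \<phi> z \<le> total \<psi> z"
  unfolding total_def using assms by (intro sum_mono) auto

lemma total_add: "total (\<lambda>t. \<phi> t + \<psi> t) z = total \<phi> z + total \<psi> z"
  by (simp add: total_def sum.distrib)

lemma total_mult: "total (\<lambda>t. c * \<phi> t) z = c * total \<phi> z"
  by (simp add: total_def sum_distrib_left)

lemma total_scale: "c \<noteq> 0 \<Longrightarrow> total \<phi> (\<lambda>i. c * z i) = total (\<lambda>t. \<phi> (c * t)) z"
  by (simp add: total_def)

lemma total_sum: "total (\<lambda>t. \<Sum>n\<in>A. \<phi> n t) z = (\<Sum>n\<in>A. total (\<phi> n) z)"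
  by (simp add: total_def sum.swap[of _ A])

section \<open>Number and ratio of the windows\<close>

locale conjugate_exponents =
  fixes p q :: real and r :: nat
  assumes p: "1 < p" and q: "1 < q" and pq: "1 / p + 1 / q = 1" and r: "1 < r"
begin

text \<open>Rounding the logarithm up keeps \<open>\<beta>\<close> at most 2; as the logarithm is at
  least 1, rounding at most doubles it.\<close>

definition M :: nat where "M = nat \<lceil>log 2 (real r)\<rceil>"

definition \<beta> :: real where "\<beta> = real r powr (1 / real M)"

lemma log_r_ge_1: "1 \<le> log 2 (real r)"
  using r by (subst le_log_iff) auto

lemma M_bounds: "1 \<le> M" "log 2 (real r) \<le> real M" "real M \<le> 2 * log 2 (real r)"
  using log_r_ge_1 unfolding M_def by linarith+

lemma beta_powr_M: "\<beta> powr (real_of_int k * real M) = real r powr real_of_int k"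
  using M_bounds r by (simp add: \<beta>_def powr_powr)

lemma ln_beta: "ln \<beta> = ln 2 * log 2 (real r) / real M"
  using r by (simp add: \<beta>_def ln_powr log_def)

text \<open>The lower bound keeps the ratio of adjacent windows away from 1 uniformly in
  \<open>r\<close>, so that geometric sums over the windows are bounded independently of
  \<open>r\<close>.\<close>

lemma ln_beta_bounds: "1 / 3 \<le> ln \<beta>" "ln \<beta> \<le> ln 2"
proof -
  have "1 / 2 \<le> log 2 (real r) / real M" "log 2 (real r) / real M \<le> 1"
    using M_bounds by (auto simp: field_simps)
  then have "ln 2 * (1 / 2) \<le> ln \<beta>" "ln \<beta> \<le> ln 2 * 1"
    unfolding ln_beta times_divide_eq_right[symmetric] by (intro mult_left_mono; simp)+
  then show "1 / 3 \<le> ln \<beta>" "ln \<beta> \<le> ln 2"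
    using ln2_ge_two_thirds by auto
qed

lemma beta_bounds: "0 < \<beta>" "1 < \<beta>" "\<beta> \<le> 2"
proof -
  show 0: "0 < \<beta>"
    using r by (simp add: \<beta>_def)
  show "1 < \<beta>"
    using ln_beta_bounds(1) 0 ln_gt_zero_iff[of \<beta>] by linarith
  show "\<beta> \<le> 2"
    using ln_beta_bounds(2) 0 by simp
qed

text \<open>Here \<open>exp t \<ge> 1 + t\<close> is used with \<open>t \<ge> 1 / (3 * q)\<close>;
  taking the inverse weakens the gap to \<open>1 / (4 * q)\<close>. This gap is the source of the
  factor \<open>q\<close> in the upper norm estimate.\<close>

lemma beta_powr_inverse_q: "\<beta> powr (- 1 / q) \<le> 1 - 1 / (4 * q)"
proof -
  have "1 + 1 / (3 * q) \<le> 1 + ln \<beta> / q"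
    using ln_beta_bounds(1) q by (simp add: field_simps)
  also have "\<dots> \<le> exp (ln \<beta> / q)"
    by (rule exp_ge_add_one_self)
  finally have "inverse (exp (ln \<beta> / q)) \<le> inverse (1 + 1 / (3 * q))"
    using q by (intro le_imp_inverse_le) (auto simp: add_pos_pos)
  moreover have "\<beta> powr (- 1 / q) = inverse (exp (ln \<beta> / q))"
    using beta_bounds by (simp add: powr_def exp_minus)
  moreover have "inverse (1 + 1 / (3 * q)) \<le> 1 - 1 / (4 * q)"
    using q by (simp add: field_simps)
  ultimately show ?thesis by linarith
qed

section \<open>Levels and windows\<close>

definition level :: "real \<Rightarrow> int" where "level a = \<lfloor>log \<beta> a\<rfloor>"

lemma level_bounds:
  assumes "0 < a"
  shows "\<beta> powr real_of_int (level a) \<le> a" "a < \<beta> powr (real_of_int (level a) + 1)"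
proof -
  have "a = \<beta> powr log \<beta> a"
    using assms beta_bounds by simp
  moreover have "real_of_int (level a) \<le> log \<beta> a" "log \<beta> a < real_of_int (level a) + 1"
    by (auto simp: level_def)
  ultimately show "\<beta> powr real_of_int (level a) \<le> a" "a < \<beta> powr (real_of_int (level a) + 1)"
    using beta_bounds by (metis powr_mono less_imp_le, metis powr_less_mono)
qed

lemma level_mult:
  assumes "0 < c" "0 < a"
  shows "level (c * a) = level c + level a \<or> level (c * a) = level c + level a + 1"
proof -
  have "log \<beta> (c * a) = log \<beta> c + log \<beta> a"
    using assms by (simp add: log_mult)
  then show ?thesis
    unfolding level_def by linarith
qed

text \<open>Powers of \<open>\<beta>\<close> shift levels exactly, without the rounding error of
  \<open>level_mult\<close>; hence blocks are rotated by scalars whose \<open>p\<close>-th power is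
  of this kind.\<close>

lemma level_shift: "0 < a \<Longrightarrow> level (\<beta> powr - real j * a) = level a - int j"
  using beta_bounds unfolding level_def by (simp add: log_mult; linarith)

text \<open>The part of the mass whose logarithm to base \<open>r\<close> has its fractional part in
  one of \<open>M\<close> equal arcs. The index is any integer and matters only modulo
  \<open>M\<close>, so that rotations become additions.\<close>

definition window :: "int \<Rightarrow> real \<Rightarrow> real" where
  "window w t = (if t \<noteq> 0 \<and> level (\<bar>t\<bar> powr p) mod int M = w mod int M then \<bar>t\<bar> powr p else 0)"

abbreviation mass :: "(nat \<Rightarrow> real) \<Rightarrow> real" where
  "mass \<equiv> total (\<lambda>t. \<bar>t\<bar> powr p)"

lemma window_zero [simp]: "window w 0 = 0"
  by (simp add: window_def)

lemma window_nonneg: "0 \<le> window w t"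
  by (simp add: window_def)

lemma total_window_nonneg: "0 \<le> total (window w) z"
  unfolding total_def by (intro sum_nonneg window_nonneg)

lemma mass_nonneg: "0 \<le> mass z"
  unfolding total_def by (intro sum_nonneg) auto

lemma total_window_le_mass: "total (window w) z \<le> mass z"
  by (rule total_mono) (simp add: window_def)

lemma mass_scale: "mass (\<lambda>i. c * z i) = \<bar>c\<bar> powr p * mass z"
proof (cases "c = 0")
  case False
  then show ?thesis
    by (simp add: total_scale abs_mult powr_mult total_mult)
qed (simp add: total_def)

lemma pnorm_eq_mass: "finite {i. z i \<noteq> 0} \<Longrightarrow> pnorm p z = mass z powr (1 / p)"
  by (subst pnorm_finite_support[of "{i. z i \<noteq> 0}"]) (auto simp: total_def)

lemma window_mod_cong: "w mod int M = w' mod int M \<Longrightarrow> window w = window w'"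
  by (simp add: window_def fun_eq_iff)

lemma sum_window: "(\<Sum>j<M. window (w + int j) t) = \<bar>t\<bar> powr p"
proof (cases "t = 0")
  case False
  define l where "l = level (\<bar>t\<bar> powr p)"
  define j where "j = nat ((l - w) mod int M)"
  have M: "0 < int M" using M_bounds by simp
  then have j: "int j = (l - w) mod int M" "j < M"
    by (auto simp: j_def nat_less_iff)
  have iff: "l mod int M = (w + int i) mod int M \<longleftrightarrow> i = j" if "i < M" for i
  proof -
    have "l mod int M = (w + int i) mod int M \<longleftrightarrow> (l - w) mod int M = int i mod int M"
      by (simp add: mod_eq_dvd_iff algebra_simps)
    then show ?thesis using j that by auto
  qed
  have "(\<Sum>i<M. window (w + int i) t) = (\<Sum>i<M. if i = j then \<bar>t\<bar> powr p else 0)"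
    using iff False by (intro sum.cong refl) (auto simp: window_def l_def)
  then show ?thesis using j by simp
qed simp

lemma sum_total_window: "(\<Sum>j<M. total (window (w + int j)) z) = mass z"
  by (simp add: total_sum[symmetric] sum_window)

lemma window_shift:
  assumes "\<bar>c\<bar> powr p = \<beta> powr - real j"
  shows "window w (c * t) = \<bar>c\<bar> powr p * window (w + int j) t"
proof (cases "t = 0")
  case False
  have "c \<noteq> 0" using assms beta_bounds by auto
  moreover have "level (\<bar>c * t\<bar> powr p) = level (\<bar>t\<bar> powr p) - int j"
    using level_shift[of "\<bar>t\<bar> powr p" j] False assms by (simp add: abs_mult powr_mult)
  moreover have "(level (\<bar>t\<bar> powr p) - int j) mod int M = w mod int M \<longleftrightarrow>
      level (\<bar>t\<bar> powr p) mod int M = (w + int j) mod int M"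
    by (simp add: mod_eq_dvd_iff algebra_simps)
  ultimately show ?thesis
    using False by (simp add: window_def abs_mult powr_mult)
qed simp

text \<open>Multiplication by \<open>c\<close> adds \<open>l\<close> or \<open>l + 1\<close> to each
  level, because floors of logarithms add up to an error of one. Hence a window pulls back into two
  adjacent windows and is also mapped into two adjacent ones.\<close>

lemma window_scale:
  fixes c :: real
  assumes "c \<noteq> 0"
  defines "l \<equiv> level (\<bar>c\<bar> powr p)"
  shows "window w (c * t) \<le> \<bar>c\<bar> powr p * (window (w - l) t + window (w - l - 1) t)"
    and "\<bar>c\<bar> powr p * window (w - l) t \<le> window w (c * t) + window (w + 1) (c * t)"
proof -
  have *: "window w (c * t) \<le> \<bar>c\<bar> powr p * (window (w - l) t + window (w - l - 1) t) \<and>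
    \<bar>c\<bar> powr p * window (w - l) t \<le> window w (c * t) + window (w + 1) (c * t)"
  proof (cases "t = 0")
    case False
    define a where "a = level (\<bar>t\<bar> powr p)"
    have l: "level (\<bar>c * t\<bar> powr p) = l + a \<or> level (\<bar>c * t\<bar> powr p) = l + a + 1"
      using level_mult[of "\<bar>c\<bar> powr p" "\<bar>t\<bar> powr p"] False assms
      by (simp add: a_def abs_mult powr_mult)
    have eq: "(l + a) mod int M = w mod int M \<longleftrightarrow> a mod int M = (w - l) mod int M"
      "(l + a + 1) mod int M = w mod int M \<longleftrightarrow> a mod int M = (w - l - 1) mod int M"
      "(l + a + 1) mod int M = (w + 1) mod int M \<longleftrightarrow> a mod int M = (w - l) mod int M"
      by (simp_all add: mod_eq_dvd_iff algebra_simps)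
    have t: "\<bar>c * t\<bar> powr p = \<bar>c\<bar> powr p * \<bar>t\<bar> powr p"
      by (simp add: abs_mult powr_mult)
    from l show ?thesis
      using False assms(1) eq unfolding window_def t a_def[symmetric] by auto
  qed simp
  then show "window w (c * t) \<le> \<bar>c\<bar> powr p * (window (w - l) t + window (w - l - 1) t)"
    and "\<bar>c\<bar> powr p * window (w - l) t \<le> window w (c * t) + window (w + 1) (c * t)"
    by auto
qed

section \<open>Flat and spread vectors\<close>

definition flat :: "(nat \<Rightarrow> real) \<Rightarrow> bool" where
  "flat z \<longleftrightarrow> (\<forall>w. mass z / (4 * real M) \<le> total (window w) z \<and>
     total (window w) z \<le> 3 * mass z / real M)"

text \<open>A weakening of \<open>flat\<close> that holds for multiples of flat vectors and survives
  disjoint sums. A general scalar shifts levels only up to an error of one, so the lower bound is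
  kept for two adjacent windows together and the upper bound doubles.\<close>

definition spread :: "(nat \<Rightarrow> real) \<Rightarrow> bool" where
  "spread z \<longleftrightarrow> (\<forall>w. mass z / (4 * real M) \<le> total (window w) z + total (window (w + 1)) z \<and>
     total (window w) z \<le> 6 * mass z / real M)"

lemma spread_scale:
  assumes "flat z"
  shows "spread (\<lambda>i. c * z i)"
proof (cases "c = 0")
  case True
  then show ?thesis by (simp add: spread_def total_def)
next
  case False
  define l where "l = level (\<bar>c\<bar> powr p)"
  have flat: "mass z / (4 * real M) \<le> total (window w) z" "total (window w) z \<le> 3 * mass z / real M" for w
    using assms by (auto simp: flat_def)
  show ?thesis
    unfolding spread_def
  proof (intro allI conjI)
    fix w
    have "mass (\<lambda>i. c * z i) / (4 * real M) = \<bar>c\<bar> powr p * (mass z / (4 * real M))"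
      by (simp add: mass_scale)
    also have "\<dots> \<le> \<bar>c\<bar> powr p * total (window (w - l)) z"
      by (intro mult_left_mono flat) auto
    also have "\<dots> \<le> total (\<lambda>t. window w (c * t) + window (w + 1) (c * t)) z"
      unfolding total_mult[symmetric] l_def using False by (intro total_mono window_scale)
    also have "\<dots> = total (window w) (\<lambda>i. c * z i) + total (window (w + 1)) (\<lambda>i. c * z i)"
      using False by (simp add: total_add total_scale)
    finally show "mass (\<lambda>i. c * z i) / (4 * real M)
        \<le> total (window w) (\<lambda>i. c * z i) + total (window (w + 1)) (\<lambda>i. c * z i)" .
    have "total (window w) (\<lambda>i. c * z i) = total (\<lambda>t. window w (c * t)) z"
      using False by (simp add: total_scale)
    also have "\<dots> \<le> total (\<lambda>t. \<bar>c\<bar> powr p * (window (w - l) t + window (w - l - 1) t)) z"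
      unfolding l_def using False by (intro total_mono window_scale)
    also have "\<dots> = \<bar>c\<bar> powr p * (total (window (w - l)) z + total (window (w - l - 1)) z)"
      by (simp add: total_mult total_add)
    also have "\<dots> \<le> \<bar>c\<bar> powr p * (3 * mass z / real M + 3 * mass z / real M)"
      by (intro mult_left_mono add_mono flat) auto
    also have "\<dots> = 6 * mass (\<lambda>i. c * z i) / real M"
      by (simp add: mass_scale)
    finally show "total (window w) (\<lambda>i. c * z i) \<le> 6 * mass (\<lambda>i. c * z i) / real M" .
  qed
qed

text \<open>Both conditions are linear in the mass and the window masses, all of which are additive
  over disjoint supports.\<close>

lemma spread_sum:
  fixes f :: "'a \<Rightarrow> nat \<Rightarrow> real"
  assumes "finite A" "\<And>n. n \<in> A \<Longrightarrow> spread (f n)" "\<And>n. n \<in> A \<Longrightarrow> finite {i. f n i \<noteq> 0}"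
    and "\<And>m n i. m \<in> A \<Longrightarrow> n \<in> A \<Longrightarrow> m \<noteq> n \<Longrightarrow> f m i = 0 \<or> f n i = 0"
  shows "spread (\<lambda>i. \<Sum>n\<in>A. f n i)"
proof -
  have W: "total (window w) (\<lambda>i. \<Sum>n\<in>A. f n i) = (\<Sum>n\<in>A. total (window w) (f n))" for w
    using assms by (intro total_sum_disjoint) auto
  have m: "mass (\<lambda>i. \<Sum>n\<in>A. f n i) = (\<Sum>n\<in>A. mass (f n))"
    using assms by (intro total_sum_disjoint) auto
  show ?thesis
    unfolding spread_def W m sum_divide_distrib sum_distrib_left sum.distrib[symmetric]
    using assms(2) by (auto intro!: sum_mono simp: spread_def)
qed

section \<open>Norm estimates for spread vectors\<close>

lemma abs_powr_inverse: "\<bar>t\<bar> = (\<bar>t\<bar> powr p) powr (1 / p)" "\<bar>t\<bar> = (\<bar>t\<bar> powr q) powr (1 / q)"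
  using p q by (simp_all add: powr_powr)

lemma powr_conj: "0 < a \<Longrightarrow> a powr (1 / p) * a powr (1 / q) = a"
  by (simp add: powr_add[symmetric] pq)

lemma powr_conj_minus: "0 < a \<Longrightarrow> a * a powr (- 1 / q) = a powr (1 / p)"
proof -
  assume a: "0 < a"
  have "a * a powr (- 1 / q) = a powr (1 + - 1 / q)"
    using a unfolding powr_add by simp
  also have "1 + - 1 / q = 1 / p"
    using pq by simp
  finally show ?thesis .
qed

text \<open>Rounding the logarithm up overshoots by at most one step, a factor
  \<open>\<beta> \<le> 2\<close>.\<close>

lemma dyadic_scale:
  assumes "0 < a"
  obtains w where "a \<le> \<beta> powr real_of_int w" "\<beta> powr real_of_int w \<le> 2 * a"
proof
  have "a = \<beta> powr log \<beta> a"
    using assms beta_bounds by simp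
  also have "\<dots> \<le> \<beta> powr real_of_int \<lceil>log \<beta> a\<rceil>"
    using beta_bounds by (intro powr_mono) auto
  finally show "a \<le> \<beta> powr real_of_int \<lceil>log \<beta> a\<rceil>" .
  have "real_of_int \<lceil>log \<beta> a\<rceil> \<le> 1 + log \<beta> a"
    by linarith
  then have "\<beta> powr real_of_int \<lceil>log \<beta> a\<rceil> \<le> \<beta> powr (1 + log \<beta> a)"
    using beta_bounds by (intro powr_mono) auto
  also have "\<dots> = \<beta> * a"
    using assms beta_bounds by (simp add: powr_add)
  also have "\<dots> \<le> 2 * a"
    using assms beta_bounds by (intro mult_right_mono) auto
  finally show "\<beta> powr real_of_int \<lceil>log \<beta> a\<rceil> \<le> 2 * a" .
qed

text \<open>In two adjacent windows starting at the scale \<open>B\<close>, each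
  \<open>\<bar>z i\<bar> powr p\<close> is within a factor 4 of \<open>B\<close> times a power of
  \<open>1 / r\<close>. The exponents of these powers satisfy Kraft's inequality, and the resulting
  functional recovers the mass of these windows up to constants.\<close>

lemma tnorm_spread_lower:
  assumes "spread z" "finite {i. z i \<noteq> 0}" "0 < mass z"
  shows "(mass z / real M) powr (1 / p) / 768 \<le> tnorm q r z"
proof -
  define m where "m = mass z / real M"
  have m: "0 < m" using assms M_bounds by (simp add: m_def)
  \<comment> \<open>Two windows hold at most \<open>6 * m\<close> each, so
    \<open>B \<ge> 12 * m\<close> bounds the whole mass that is used and makes the Kraft sum at most
    1.\<close>
  obtain w where w: "12 * m \<le> \<beta> powr real_of_int w" "\<beta> powr real_of_int w \<le> 2 * (12 * m)"
    using dyadic_scale[of "12 * m"] m by auto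
  define B where "B = \<beta> powr real_of_int w"
  have B: "12 * m \<le> B" "B \<le> 24 * m" "0 < B"
    using w m beta_bounds by (auto simp: B_def)
  define a where "a i = \<bar>z i\<bar> powr p" for i
  define G where "G = {i. z i \<noteq> 0 \<and> (level (a i) mod int M = w mod int M \<or>
      level (a i) mod int M = (w + 1) mod int M)}"
  have G: "finite G" using assms(2) by (rule finite_subset[rotated]) (auto simp: G_def)
  have a_pos: "0 < a i" if "i \<in> G" for i
    using that by (auto simp: a_def G_def)
  have W: "total (window w') z = (\<Sum>i\<in>G. window w' (z i))" if "w' = w \<or> w' = w + 1" for w'
    unfolding total_def using assms(2) that
    by (intro sum.mono_neutral_right) (auto simp: G_def window_def a_def)
  have "(\<Sum>i\<in>G. a i) \<le> (\<Sum>i\<in>G. window w (z i) + window (w + 1) (z i))"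
    by (intro sum_mono) (auto simp: G_def window_def a_def)
  also have "\<dots> = total (window w) z + total (window (w + 1)) z"
    by (simp add: W sum.distrib)
  also have "\<dots> \<le> 6 * m + 6 * m"
    using assms(1) by (intro add_mono) (auto simp: spread_def m_def)
  finally have mass_G: "(\<Sum>i\<in>G. a i) \<le> B"
    using B by simp
  have "m / 4 \<le> total (window w) z + total (window (w + 1)) z"
    using assms(1) by (simp add: spread_def m_def mult.commute)
  also have "\<dots> = (\<Sum>i\<in>G. window w (z i) + window (w + 1) (z i))"
    by (simp add: W sum.distrib)
  \<comment> \<open>For \<open>M = 1\<close> the two windows coincide and each coordinate is counted
    twice, whence the factor 2.\<close>
  also have "\<dots> \<le> (\<Sum>i\<in>G. 2 * a i)"
    by (intro sum_mono) (auto simp: window_def a_def)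
  finally have mass_G': "m / 8 \<le> (\<Sum>i\<in>G. a i)"
    by (simp add: sum_distrib_left[symmetric])
  \<comment> \<open>Up to \<open>\<kappa>\<close> full turns of \<open>M\<close> levels, each worth
    a factor \<open>r\<close>, the value \<open>a i\<close> lies in the two windows above
    \<open>B\<close>; these span a factor \<open>\<beta> powr 2 \<le> 4\<close>.\<close>
  have "\<exists>k::nat. B * (1 / real r ^ k) \<le> a i \<and> a i \<le> 4 * B * (1 / real r ^ k)" if i: "i \<in> G" for i
  proof -
    obtain e \<kappa> where e: "e = 0 \<or> e = 1" "level (a i) = w + e + \<kappa> * int M"
    proof -
      from i have "(level (a i) - w) mod int M = 0 \<or> (level (a i) - (w + 1)) mod int M = 0"
        by (auto simp: G_def mod_eq_dvd_iff dvd_eq_mod_eq_0)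
      then show ?thesis
        using that[of 0] that[of 1] by (auto simp: mod_eq_0_iff_dvd dvd_def algebra_simps)
    qed
    define R where "R = real r powr real_of_int \<kappa>"
    have BR: "\<beta> powr (real_of_int w + real_of_int \<kappa> * real M + s) = B * R * \<beta> powr s" for s
      by (simp add: powr_add B_def R_def beta_powr_M)
    have "B * R * 1 \<le> B * R * \<beta> powr real_of_int e"
      using e(1) B beta_bounds by (intro mult_left_mono) (auto simp: R_def)
    also have "\<dots> = \<beta> powr real_of_int (level (a i))"
      unfolding BR[symmetric] e(2) by (simp add: add_ac)
    also have "\<dots> \<le> a i"
      using level_bounds a_pos[OF i] by simp
    finally have lower: "B * R \<le> a i" by simp
    have "a i \<le> \<beta> powr (real_of_int (level (a i)) + 1)"
      using level_bounds(2)[OF a_pos[OF i]] by simp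
    also have "\<dots> = B * R * \<beta> powr (real_of_int e + 1)"
      unfolding BR[symmetric] e(2) by (simp add: add_ac)
    also have "\<dots> \<le> B * R * \<beta> powr 2"
      using e(1) B beta_bounds by (intro mult_left_mono powr_mono) (auto simp: R_def)
    also have "\<dots> \<le> B * R * 2 powr 2"
      using B beta_bounds by (intro mult_left_mono powr_mono2) (auto simp: R_def)
    finally have upper: "a i \<le> 4 * B * R" by (simp add: algebra_simps)
    \<comment> \<open>No single coordinate exceeds the mass of \<open>G\<close>, which is at most
      \<open>B\<close>; so \<open>\<kappa>\<close> is not positive and yields a natural
      exponent.\<close>
    have "a i \<le> (\<Sum>i\<in>G. a i)"
      using G i by (intro member_le_sum) (auto simp: a_def)
    then have "B * R \<le> B * 1"
      using lower mass_G by simp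
    then have "R \<le> 1" using B by simp
    then have "\<kappa> \<le> 0"
      using r powr_less_mono[of 0 "real_of_int \<kappa>" "real r"] by (force simp: R_def not_le[symmetric])
    then have "R = 1 / real r ^ nat (- \<kappa>)"
      using r by (simp add: R_def powr_realpow[symmetric] powr_minus_divide[symmetric])
    then show ?thesis using lower upper by auto
  qed
  then obtain k :: "nat \<Rightarrow> nat" where
    k: "\<And>i. i \<in> G \<Longrightarrow> B * (1 / real r ^ k i) \<le> a i" "\<And>i. i \<in> G \<Longrightarrow> a i \<le> 4 * B * (1 / real r ^ k i)"
    by metis
  define y where "y = (\<lambda>i. if i \<in> G then sgn (z i) * real r powr (- real (k i) / q) else 0)"
  have "y \<in> KM q r"
    unfolding y_def
  proof (rule kraft_vector_in_KM)
    show "G \<noteq> {}" using mass_G' m by auto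
    have "B * (\<Sum>i\<in>G. 1 / real r ^ k i) \<le> (\<Sum>i\<in>G. a i)"
      unfolding sum_distrib_left by (intro sum_mono k)
    also have "\<dots> \<le> B * 1"
      using mass_G by simp
    finally show "(\<Sum>i\<in>G. 1 / real r ^ k i) \<le> 1"
      using B by simp
  qed (use r G in \<open>auto simp: G_def sgn_if\<close>)
  \<comment> \<open>The value \<open>96 * m\<close> bounds \<open>4 * B\<close>, and
    \<open>768 = 8 * 96\<close> comes from the mass of \<open>G\<close>, at least
    \<open>m / 8\<close>, and from \<open>96 powr (- 1 / q) \<ge> 1 / 96\<close>.\<close>
  have "(m powr (1 / p)) / 768 \<le> (m / 8) * (96 * m) powr (- 1 / q)"
  proof -
    have "96 powr - 1 \<le> (96::real) powr (- 1 / q)"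
      using q by (intro powr_mono) (auto simp: field_simps)
    then have "(m * m powr (- 1 / q)) * (1 / 96) \<le> (m * m powr (- 1 / q)) * 96 powr (- 1 / q)"
      using m by (intro mult_left_mono) (auto simp: powr_minus_divide)
    then show ?thesis
      using m by (simp add: powr_conj_minus[symmetric] powr_mult)
  qed
  also have "\<dots> \<le> (\<Sum>i\<in>G. a i) * (4 * B) powr (- 1 / q)"
  proof (rule mult_mono)
    show "(96 * m) powr (- 1 / q) \<le> (4 * B) powr (- 1 / q)"
      using B q by (intro powr_mono2') auto
    show "0 \<le> (\<Sum>i\<in>G. a i)"
      by (intro sum_nonneg) (simp add: a_def)
  qed (use mass_G' in auto)
  also have "\<dots> = (\<Sum>i\<in>G. a i * (4 * B) powr (- 1 / q))"
    by (rule sum_distrib_right)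
  also have "\<dots> \<le> (\<Sum>i\<in>G. z i * y i)"
  proof (rule sum_mono)
    fix i assume i: "i \<in> G"
    \<comment> \<open>The exponent \<open>k i\<close> was chosen such that
      \<open>a i / (4 * B)\<close> is at most the \<open>q\<close>-th power of
      \<open>\<bar>y i\<bar>\<close>.\<close>
    have "a i * (4 * B) powr (- 1 / q) = a i powr (1 / p) * (a i / (4 * B)) powr (1 / q)"
      using B a_pos[OF i] powr_conj[OF a_pos[OF i]]
      by (simp add: powr_divide powr_minus_divide mult.assoc[symmetric])
    also have "\<dots> \<le> a i powr (1 / p) * (1 / real r ^ k i) powr (1 / q)"
      using k(2)[OF i] B a_pos[OF i] q by (intro mult_left_mono powr_mono2) (auto simp: divide_simps mult_ac)
    also have "(1 / real r ^ k i) powr (1 / q) = real r powr (- real (k i) / q)"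
      using r by (simp add: powr_realpow[symmetric] powr_minus_divide[symmetric] powr_powr)
    also have "a i powr (1 / p) = \<bar>z i\<bar>"
      by (simp add: a_def abs_powr_inverse(1)[symmetric])
    also have "\<bar>z i\<bar> * real r powr (- real (k i) / q) = z i * y i"
      using i by (simp add: y_def mult.assoc[symmetric] abs_sgn)
    finally show "a i * (4 * B) powr (- 1 / q) \<le> z i * y i" .
  qed
  also have "\<dots> = pairing z y"
    unfolding pairing_def using G r by (intro sum.mono_neutral_right[symmetric])
      (auto simp: y_def G_def sgn_if split: if_splits)
  also have "\<dots> \<le> tnorm q r z"
    using p q pq r \<open>y \<in> KM q r\<close> lp_finite_support[OF assms(2)] by (intro pairing_le_tnorm[of p]) auto
  finally show ?thesis by (simp add: m_def)
qed

lemma geometric_bound: "(\<Sum>j<n. \<beta> powr (- real j / q)) \<le> 4 * q"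
proof -
  define x where "x = \<beta> powr (- 1 / q)"
  have x: "0 < x" "1 / (4 * q) \<le> 1 - x"
    using beta_bounds beta_powr_inverse_q by (auto simp: x_def)
  have "0 < 1 / (4 * q)" using q by simp
  with x have x1: "x < 1" by linarith
  have "(\<Sum>j<n. \<beta> powr (- real j / q)) = (\<Sum>j<n. x ^ j)"
    using beta_bounds by (intro sum.cong) (auto simp: x_def powr_realpow[symmetric] powr_powr)
  also have "\<dots> = (1 - x ^ n) / (1 - x)"
    using x1 by (simp add: sum_gp_strict)
  also have "\<dots> \<le> 1 / (1 - x)"
    using x x1 by (intro divide_right_mono) auto
  also have "\<dots> \<le> 1 / (1 / (4 * q))"
    using x q x1 by (intro divide_left_mono) auto
  finally show ?thesis by simp
qed

text \<open>Let a coordinate carry \<open>a = \<bar>z i\<bar> powr p\<close> and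
  \<open>b = \<bar>y i\<bar> powr q\<close>. If \<open>a \<le> B * b\<close>, its contribution is at
  most \<open>B powr (1 / p) * b\<close>. Otherwise, as \<open>b\<close> is a power of
  \<open>1 / r\<close>, the window \<open>w + j\<close> of \<open>a\<close> improves
  \<open>b < a / B\<close> to \<open>b \<le> a / \<beta> powr (w + j)\<close>, so this window enters
  with a weight decaying geometrically in \<open>j\<close>.\<close>

lemma tnorm_spread_upper:
  assumes "spread z" "finite {i. z i \<noteq> 0}" "0 < mass z"
  shows "tnorm q r z \<le> 26 * q * (mass z / real M) powr (1 / p)"
proof (rule tnorm_leI)
  fix y assume "y \<in> KM q r"
  then have y: "grid_vector q r y"
    using q r by (intro KM_imp_grid_vector) auto
  define m where "m = mass z / real M"
  have m: "0 < m" using assms M_bounds by (simp add: m_def)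
  obtain w where w: "m \<le> \<beta> powr real_of_int w" "\<beta> powr real_of_int w \<le> 2 * m"
    using dyadic_scale[OF m] by auto
  define B where "B = \<beta> powr real_of_int w"
  have B: "m \<le> B" "B \<le> 2 * m" "0 < B"
    using w m by (auto simp: B_def)
  \<comment> \<open>A bound for the value per unit of mass that a coordinate in window
    \<open>w + j\<close> yields in the second case.\<close>
  define C where "C j = \<beta> powr (- (real_of_int w + real j) / q)" for j :: nat
  define Z where "Z = {i. z i \<noteq> 0}"
  define A where "A = {i. y i \<noteq> 0}"
  have A: "finite A" "(\<Sum>i\<in>A. \<bar>y i\<bar> powr q) \<le> 1"
    using y by (auto simp: grid_vector_def A_def)
  have bound: "z i * y i \<le> B powr (1 / p) * \<bar>y i\<bar> powr q + (\<Sum>j<M. C j * window (w + int j) (z i))"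
    if i: "i \<in> A \<inter> Z" for i
  proof -
    define a where "a = \<bar>z i\<bar> powr p"
    define b where "b = \<bar>y i\<bar> powr q"
    obtain k :: nat where k: "b = 1 / real r ^ k"
      using y i by (auto simp: grid_vector_def A_def b_def)
    have pos: "0 < a" "0 < b"
      using i by (auto simp: a_def b_def A_def Z_def)
    have W: "0 \<le> (\<Sum>j<M. C j * window (w + int j) (z i))"
      by (intro sum_nonneg mult_nonneg_nonneg window_nonneg) (simp add: C_def)
    have zy: "z i * y i \<le> a powr (1 / p) * b powr (1 / q)"
      using abs_ge_self[of "z i * y i"] abs_powr_inverse(1)[of "z i"] abs_powr_inverse(2)[of "y i"]
      by (simp add: a_def b_def abs_mult)
    show ?thesis
    proof (cases "a \<le> B * b")
      case True
      have "a powr (1 / p) * b powr (1 / q) \<le> (B * b) powr (1 / p) * b powr (1 / q)"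
        using True pos p by (intro mult_right_mono powr_mono2) auto
      also have "\<dots> = B powr (1 / p) * b"
        using pos B powr_conj[OF pos(2)] by (simp add: powr_mult)
      finally show ?thesis
        using zy W by (simp add: b_def)
    next
      case False
      define j where "j = nat ((level a - w) mod int M)"
      have M: "0 < int M" using M_bounds by simp
      then have j: "int j = (level a - w) mod int M" "j < M"
        by (auto simp: j_def nat_less_iff)
      have b_beta: "b = \<beta> powr (real_of_int (- int k) * real M)"
        unfolding beta_powr_M k using r by (simp add: powr_minus_divide powr_realpow)
      have "\<beta> powr (real_of_int (w - int k * int M)) = B * b"
        unfolding b_beta B_def powr_add[symmetric] by (simp add: algebra_simps)
      then have "real_of_int (w - int k * int M) \<le> log \<beta> a"
        using False pos beta_bounds by (subst le_log_iff) auto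
      then have "w - int k * int M \<le> level a"
        by (simp add: level_def le_floor_iff)
      \<comment> \<open>A residue modulo \<open>M\<close> is at most the nonnegative number it comes
        from; so \<open>a\<close> exceeds \<open>B * b\<close> by at least \<open>j\<close>
        levels.\<close>
      then have "(level a - w + int k * int M) mod int M \<le> level a - w + int k * int M"
        by (intro zmod_le_nonneg_dividend) simp
      then have "w + int j \<le> level a + int k * int M"
        by (simp add: j)
      then have le: "real_of_int w + real j - real k * real M \<le> real_of_int (level a)"
        by (simp add: of_int_le_iff[where 'a = real, symmetric] del: of_int_le_iff)
      have "\<beta> powr (real_of_int w + real j) * b = \<beta> powr (real_of_int w + real j - real k * real M)"
        unfolding b_beta powr_add[symmetric] by simp
      also have "\<dots> \<le> \<beta> powr real_of_int (level a)"
        using le beta_bounds by (intro powr_mono) auto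
      also have "\<dots> \<le> a"
        using level_bounds pos by simp
      finally have "b \<le> a / \<beta> powr (real_of_int w + real j)"
        using beta_bounds by (simp add: field_simps)
      moreover have C_j: "C j = 1 / \<beta> powr ((real_of_int w + real j) / q)"
        by (simp only: C_def minus_divide_left[symmetric] powr_minus_divide)
      ultimately have "a powr (1 / p) * b powr (1 / q)
          \<le> a powr (1 / p) * (a / \<beta> powr (real_of_int w + real j)) powr (1 / q)"
        using pos q by (intro mult_left_mono powr_mono2) auto
      also have "\<dots> = C j * a"
        using pos powr_conj[OF pos(1)] C_j by (simp add: powr_divide powr_powr)
      also have "\<dots> = C j * window (w + int j) (z i)"
        using i j by (simp add: window_def a_def Z_def mod_add_right_eq)
      also have "\<dots> \<le> (\<Sum>j<M. C j * window (w + int j) (z i))"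
        using j by (intro member_le_sum) (auto simp: C_def window_nonneg)
      finally have "z i * y i \<le> (\<Sum>j<M. C j * window (w + int j) (z i))"
        using zy by simp
      moreover have "0 \<le> B powr (1 / p) * \<bar>y i\<bar> powr q"
        by simp
      ultimately show ?thesis by linarith
    qed
  qed
  have "pairing z y = (\<Sum>i\<in>A \<inter> Z. z i * y i)"
    unfolding pairing_def A_def[symmetric] using A by (intro sum.mono_neutral_right) (auto simp: Z_def)
  also have "\<dots> \<le> (\<Sum>i\<in>A \<inter> Z. B powr (1 / p) * \<bar>y i\<bar> powr q + (\<Sum>j<M. C j * window (w + int j) (z i)))"
    by (intro sum_mono bound)
  also have "\<dots> = B powr (1 / p) * (\<Sum>i\<in>A \<inter> Z. \<bar>y i\<bar> powr q)
      + (\<Sum>i\<in>A \<inter> Z. \<Sum>j<M. C j * window (w + int j) (z i))"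
    by (simp add: sum.distrib sum_distrib_left)
  also have "\<dots> \<le> B powr (1 / p) * 1 + (\<Sum>i\<in>Z. \<Sum>j<M. C j * window (w + int j) (z i))"
  proof (intro add_mono mult_left_mono)
    have "(\<Sum>i\<in>A \<inter> Z. \<bar>y i\<bar> powr q) \<le> (\<Sum>i\<in>A. \<bar>y i\<bar> powr q)"
      using A by (intro sum_mono2) auto
    then show "(\<Sum>i\<in>A \<inter> Z. \<bar>y i\<bar> powr q) \<le> 1" using A by linarith
    show "(\<Sum>i\<in>A \<inter> Z. \<Sum>j<M. C j * window (w + int j) (z i))
        \<le> (\<Sum>i\<in>Z. \<Sum>j<M. C j * window (w + int j) (z i))"
      using assms(2) by (intro sum_mono2 sum_nonneg mult_nonneg_nonneg window_nonneg)
        (auto simp: Z_def C_def)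
  qed simp
  also have "(\<Sum>i\<in>Z. \<Sum>j<M. C j * window (w + int j) (z i)) = (\<Sum>j<M. C j * total (window (w + int j)) z)"
    unfolding total_def sum_distrib_left Z_def by (rule sum.swap)
  also have "\<dots> \<le> (\<Sum>j<M. C j * (6 * m))"
    using assms(1) by (intro sum_mono mult_left_mono) (auto simp: spread_def m_def C_def)
  also have "\<dots> = 6 * (m * B powr (- 1 / q)) * (\<Sum>j<M. \<beta> powr (- real j / q))"
    unfolding sum_distrib_left
    by (intro sum.cong) (auto simp: C_def B_def powr_powr powr_add[symmetric] diff_divide_distrib add_divide_distrib)
  \<comment> \<open>In units of \<open>m powr (1 / p)\<close>, the windows contribute
    \<open>6 * (4 * q)\<close> and the coordinates of the first case at most \<open>2 * q\<close>,
    together \<open>26 * q\<close>.\<close>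
  also have "\<dots> \<le> 6 * (m * m powr (- 1 / q)) * (4 * q)"
    using m B q by (intro mult_mono geometric_bound powr_mono2' sum_nonneg mult_nonneg_nonneg) auto
  also have "\<dots> = 24 * q * m powr (1 / p)"
    unfolding powr_conj_minus[OF m] by simp
  also have "B powr (1 / p) * 1 \<le> 2 * q * m powr (1 / p)"
  proof -
    have "B powr (1 / p) \<le> (2 * m) powr (1 / p)"
      using B p by (intro powr_mono2) auto
    also have "\<dots> = 2 powr (1 / p) * m powr (1 / p)"
      using m by (simp add: powr_mult)
    also have "\<dots> \<le> 2 powr 1 * m powr (1 / p)"
      using p by (intro mult_right_mono powr_mono) auto
    also have "\<dots> \<le> 2 * q * m powr (1 / p)"
      using q by (intro mult_right_mono) auto
    finally show ?thesis by simp
  qed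
  finally show "pairing z y \<le> 26 * q * (mass z / real M) powr (1 / p)"
    by (simp add: m_def)
qed

end

section \<open>Blocks with equidistributed levels\<close>

text \<open>Gaussian elimination, one equation at a time: a vector with nonzero \<open>k\<close>-th
  entry is the pivot, multiples of it are subtracted from the others to clear that entry, and its
  own coefficient collects these subtractions.\<close>

lemma underdetermined_nontrivial:
  fixes v :: "'a \<Rightarrow> nat \<Rightarrow> real"
  assumes "finite I" "k < card I"
  shows "\<exists>c. (\<exists>i\<in>I. c i \<noteq> 0) \<and> (\<forall>j<k. (\<Sum>i\<in>I. c i * v i j) = 0)"
  using assms
proof (induction k arbitrary: I v)
  case 0
  then have "\<exists>i. i \<in> I" by (metis card_gt_0_iff ex_in_conv)
  then show ?case by (intro exI[of _ "\<lambda>_. 1"]) auto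
next
  case (Suc k)
  show ?case
  proof (cases "\<forall>i\<in>I. v i k = 0")
    case True
    with Suc.IH[of I v] Suc.prems show ?thesis
      by (auto simp: less_Suc_eq)
  next
    case False
    then obtain i0 where i0: "i0 \<in> I" "v i0 k \<noteq> 0" by blast
    define v' where "v' i j = v i j - v i k / v i0 k * v i0 j" for i j
    have "finite (I - {i0})" "k < card (I - {i0})"
      using Suc.prems i0 by auto
    from Suc.IH[OF this, of v'] obtain c where c: "\<exists>i\<in>I - {i0}. c i \<noteq> 0"
      "\<And>j. j < k \<Longrightarrow> (\<Sum>i\<in>I - {i0}. c i * v' i j) = 0"
      by blast
    define c' where "c' = c(i0 := - (\<Sum>i\<in>I - {i0}. c i * (v i k / v i0 k)))"
    have eq: "(\<Sum>i\<in>I. c' i * v i j) = (\<Sum>i\<in>I - {i0}. c i * v' i j)" for j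
    proof -
      have "(\<Sum>i\<in>I. c' i * v i j) = c' i0 * v i0 j + (\<Sum>i\<in>I - {i0}. c i * v i j)"
        using Suc.prems i0 by (simp add: sum.remove[of I i0] c'_def)
      also have "\<dots> = (\<Sum>i\<in>I - {i0}. c i * v' i j)"
        by (simp add: c'_def v'_def sum_distrib_right right_diff_distrib sum_subtractf mult.assoc)
      finally show ?thesis .
    qed
    have "(\<Sum>i\<in>I. c' i * v i j) = 0" if "j < Suc k" for j
    proof (cases "j = k")
      case True
      then show ?thesis using i0 by (simp add: eq v'_def)
    next
      case False
      then show ?thesis using c(2)[of j] that by (simp add: eq)
    qed
    moreover have "\<exists>i\<in>I. c' i \<noteq> 0"
      using c(1) by (auto simp: c'_def)
    ultimately show ?thesis by blast
  qed
qed

section \<open>Almost disjoint blocks inside a subspace\<close>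

lemma closed_subspace_lpD:
  assumes "closed_subspace_lp p X"
  shows "x \<in> X \<Longrightarrow> x \<in> lp p" "(\<lambda>i. 0) \<in> X"
    and "x \<in> X \<Longrightarrow> y \<in> X \<Longrightarrow> (\<lambda>i. x i + y i) \<in> X"
    and "x \<in> X \<Longrightarrow> (\<lambda>i. c * x i) \<in> X"
    and "(\<And>n. s n \<in> X) \<Longrightarrow> x \<in> lp p \<Longrightarrow> (\<lambda>n. pnorm p (\<lambda>i. s n i - x i)) \<longlonglongrightarrow> 0 \<Longrightarrow> x \<in> X"
  using assms unfolding closed_subspace_lp_def by (blast, blast, blast, blast, blast)

lemma closed_subspace_sum:
  assumes "closed_subspace_lp p X" "\<And>n. n \<in> A \<Longrightarrow> f n \<in> X"
  shows "(\<lambda>i. \<Sum>n\<in>A. c n * f n i) \<in> X"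
  using assms(2)
proof (induction A rule: infinite_finite_induct)
  case (insert n A)
  have "(\<lambda>i. c n * f n i + (\<Sum>n\<in>A. c n * f n i)) \<in> X"
    using insert by (intro closed_subspace_lpD(3,4)[OF assms(1)]) auto
  then show ?case using insert by simp
qed (use closed_subspace_lpD(2)[OF assms(1)] in simp_all)

text \<open>The \<open>k\<close> vanishing conditions on \<open>k + 1\<close> independent vectors
  leave a nontrivial combination, which is nonzero by independence.\<close>

lemma infinite_dim_vanishing:
  assumes "closed_subspace_lp p X" "infinite_dim X"
  obtains x i where "x \<in> X" "\<And>j. j < k \<Longrightarrow> x j = 0" "x i \<noteq> 0"
proof -
  obtain vs where vs: "\<And>i. i < Suc k \<Longrightarrow> vs i \<in> X" "lin_indep_fin (Suc k) vs"
    using assms(2) unfolding infinite_dim_def by blast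
  obtain c where c: "\<exists>i\<in>{..<Suc k}. c i \<noteq> 0" "\<forall>j<k. (\<Sum>i<Suc k. c i * vs i j) = 0"
    using underdetermined_nontrivial[of "{..<Suc k}" k vs] by auto
  then obtain j where "(\<Sum>i<Suc k. c i * vs i j) \<noteq> 0"
    using vs(2) unfolding lin_indep_fin_def by blast
  moreover have "(\<lambda>j. \<Sum>i<Suc k. c i * vs i j) \<in> X"
    using vs(1) by (intro closed_subspace_sum[OF assms(1)]) auto
  ultimately show ?thesis
    using that c(2) by blast
qed

definition cut :: "nat \<Rightarrow> nat \<Rightarrow> (nat \<Rightarrow> real) \<Rightarrow> nat \<Rightarrow> real" where
  "cut k k' x = (\<lambda>i. if k \<le> i \<and> i < k' then x i else 0)"

lemma finite_support_cut: "finite {i. cut k k' x i \<noteq> 0}"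
  by (rule finite_subset[of _ "{..<k'}"]) (auto simp: cut_def)

lemma pnorm_tail_less:
  assumes "1 \<le> p" "x \<in> lp p" "0 < \<epsilon>"
  obtains N where "\<And>n. N \<le> n \<Longrightarrow> pnorm p (\<lambda>i. if i < n then 0 else x i) < \<epsilon>"
proof -
  have s: "summable (\<lambda>i. \<bar>x i\<bar> powr p)"
    using assms by (simp add: lp_def)
  obtain N where N: "\<And>n. N \<le> n \<Longrightarrow> norm (\<Sum>i. \<bar>x (i + n)\<bar> powr p) < \<epsilon> powr p"
    using suminf_exist_split[OF _ s, of "\<epsilon> powr p"] assms by auto
  show ?thesis
  proof (rule that)
    fix n assume n: "N \<le> n"
    define f where "f i = (if i < n then 0 else x i)" for i
    have f: "summable (\<lambda>i. \<bar>f i\<bar> powr p)"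
      by (rule summable_comparison_test'[OF s]) (auto simp: f_def)
    have "(\<Sum>i. \<bar>f i\<bar> powr p) = (\<Sum>i. \<bar>x (i + n)\<bar> powr p)"
      using suminf_split_initial_segment[OF f, of n] by (simp add: f_def)
    also have "\<dots> < \<epsilon> powr p"
      using N[OF n] by simp
    finally have "(\<Sum>i. \<bar>f i\<bar> powr p) powr (1 / p) < (\<epsilon> powr p) powr (1 / p)"
      using f assms(1) by (intro powr_less_mono2 suminf_nonneg) auto
    then show "pnorm p (\<lambda>i. if i < n then 0 else x i) < \<epsilon>"
      using assms by (simp add: pnorm_def f_def powr_powr)
  qed
qed

text \<open>A vector vanishing below \<open>k\<close> is truncated where its tail is negligible and
  then scaled such that the truncated part, rather than the vector itself, has norm 1.\<close>

lemma almost_block: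
  assumes "1 < p" "closed_subspace_lp p X" "infinite_dim X" "0 < \<epsilon>"
  obtains x k' where "x \<in> X" "k < k'" "total (\<lambda>t. \<bar>t\<bar> powr p) (cut k k' x) = 1"
    "pnorm p (\<lambda>i. x i - cut k k' x i) \<le> \<epsilon>"
proof -
  obtain x i where x: "x \<in> X" "\<And>j. j < k \<Longrightarrow> x j = 0" "x i \<noteq> 0"
    using infinite_dim_vanishing[OF assms(2,3)] by metis
  have lp: "x \<in> lp p"
    using closed_subspace_lpD(1)[OF assms(2)] x(1) .
  \<comment> \<open>The later division by \<open>A \<ge> \<bar>x i\<bar>\<close> turns this
    tolerance into \<open>\<epsilon>\<close>.\<close>
  obtain N where N: "\<And>n. N \<le> n \<Longrightarrow> pnorm p (\<lambda>i. if i < n then 0 else x i) < \<epsilon> * \<bar>x i\<bar>"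
    using pnorm_tail_less[of p x "\<epsilon> * \<bar>x i\<bar>"] assms lp x by auto
  \<comment> \<open>\<open>Suc i\<close> keeps the nonzero coordinate \<open>i\<close> inside the
    block.\<close>
  define k' where "k' = max N (Suc i)"
  define S where "S = (\<Sum>i<k'. \<bar>x i\<bar> powr p)"
  define A where "A = S powr (1 / p)"
  have S: "\<bar>x i\<bar> powr p \<le> S"
    unfolding S_def by (rule member_le_sum) (auto simp: k'_def)
  then have "(\<bar>x i\<bar> powr p) powr (1 / p) \<le> A"
    unfolding A_def using assms(1) by (intro powr_mono2) auto
  then have A: "\<bar>x i\<bar> \<le> A" "0 < A"
    using assms(1) x by (auto simp: powr_powr)
  have "0 < S" using S x by (smt (verit) powr_gt_zero)
  then have A_powr: "A powr p = S"
    using assms(1) by (simp add: A_def powr_powr)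
  let ?x = "\<lambda>j. 1 / A * x j"
  have "?x \<in> X"
    using x(1) by (rule closed_subspace_lpD(4)[OF assms(2)])
  moreover have "k < k'"
  proof -
    have "k \<le> i" using x(2)[of i] x(3) by linarith
    then show ?thesis by (simp add: k'_def)
  qed
  moreover have "total (\<lambda>t. \<bar>t\<bar> powr p) (cut k k' ?x) = 1"
  proof -
    have "total (\<lambda>t. \<bar>t\<bar> powr p) (cut k k' ?x) = (\<Sum>j<k'. \<bar>cut k k' ?x j\<bar> powr p)"
      by (intro total_superset) (auto simp: cut_def)
    also have "\<dots> = (\<Sum>j<k'. \<bar>x j\<bar> powr p / S)"
      using x(2) A by (intro sum.cong) (auto simp: cut_def powr_divide A_powr not_le abs_divide)
    finally show ?thesis
      using \<open>0 < S\<close> by (simp add: sum_divide_distrib[symmetric] S_def)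
  qed
  moreover have "pnorm p (\<lambda>j. ?x j - cut k k' ?x j) \<le> \<epsilon>"
  proof -
    define f where "f = (\<lambda>i. if i < k' then 0 else x i)"
    have "f = (\<lambda>j. x j - cut 0 k' x j)"
      by (auto simp: f_def cut_def)
    then have f: "f \<in> lp p"
      using lp_diff[OF _ lp lp_finite_support[OF finite_support_cut]] assms(1) by simp
    have "(\<lambda>j. ?x j - cut k k' ?x j) = (\<lambda>j. 1 / A * f j)"
      using x(2) by (auto simp: f_def cut_def not_le)
    then have "pnorm p (\<lambda>j. ?x j - cut k k' ?x j) = 1 / A * pnorm p f"
      using pnorm_scale[OF _ f, of "1 / A"] assms(1) A by simp
    also have "\<dots> \<le> 1 / A * (\<epsilon> * \<bar>x i\<bar>)"
      using N[of k'] A by (intro mult_left_mono) (auto simp: f_def k'_def)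
    also have "\<dots> \<le> \<epsilon>"
      using A assms(4) by (simp add: divide_simps mult_left_mono)
    finally show ?thesis .
  qed
  ultimately show ?thesis by (rule that)
qed

lemma almost_block_sequence:
  fixes \<epsilon> :: "nat \<Rightarrow> real"
  assumes "1 < p" "closed_subspace_lp p X" "infinite_dim X" "\<And>n. 0 < \<epsilon> n"
  obtains x z where "\<And>n. x n \<in> X" "\<And>n. finite {i. z n i \<noteq> 0}"
    "\<And>m n i. m \<noteq> n \<Longrightarrow> z m i = 0 \<or> z n i = 0"
    "\<And>n. total (\<lambda>t. \<bar>t\<bar> powr p) (z n) = 1"
    "\<And>n. pnorm p (\<lambda>i. x n i - z n i) \<le> \<epsilon> n"
proof -
  define P where "P k n x k' \<longleftrightarrow> x \<in> X \<and> k < k' \<and> total (\<lambda>t. \<bar>t\<bar> powr p) (cut k k' x) = 1 \<and>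
      pnorm p (\<lambda>i. x i - cut k k' x i) \<le> \<epsilon> n" for k n x k'
  have "\<exists>x k'. P k n x k'" for k n
    using almost_block[OF assms(1-3) assms(4)[of n], of k] unfolding P_def by blast
  then obtain x k' where "\<And>k n. P k n (x k n) (k' k n)"
    by metis
  then have xk: "x k n \<in> X" "k < k' k n"
    "total (\<lambda>t. \<bar>t\<bar> powr p) (cut k (k' k n) (x k n)) = 1"
    "pnorm p (\<lambda>i. x k n i - cut k (k' k n) (x k n) i) \<le> \<epsilon> n" for k n
    unfolding P_def by blast+
  \<comment> \<open>Each block starts where the previous one ends, which makes the truncations
    disjoint.\<close>
  define K where "K = rec_nat 0 (\<lambda>n k. k' k n)"
  have K_Suc: "K (Suc n) = k' (K n) n" for n
    by (simp add: K_def)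
  have mono: "strict_mono K"
    by (rule strict_monoI_Suc) (simp add: K_Suc xk)
  define z where "z n = cut (K n) (K (Suc n)) (x (K n) n)" for n
  have disj: "z m i = 0 \<or> z n i = 0" if "m < n" for m n i
    using strict_mono_mono[OF mono] monoD[of K "Suc m" n] that by (auto simp: z_def cut_def)
  show ?thesis
  proof (rule that)
    show "z m i = 0 \<or> z n i = 0" if "m \<noteq> n" for m n i
      using disj[of m n i] disj[of n m i] that by linarith
    show "finite {i. z n i \<noteq> 0}" for n
      unfolding z_def by (rule finite_support_cut)
  qed (use xk in \<open>auto simp: z_def K_Suc\<close>)
qed

section \<open>Equal window profiles and their rotations\<close>

context conjugate_exponents
begin

text \<open>Rounded window masses take finitely many values, so infinitely many blocks share one
  rounded profile. The precision \<open>1 / (2 * M)\<close> adds up over all windows to an error of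
  1/2, half of the mass.\<close>

lemma almost_equidistributed_sequence:
  assumes "closed_subspace_lp p X" "infinite_dim X" "0 < \<delta>"
  obtains x z \<mu> where "\<And>n. x n \<in> X" "\<And>n. finite {i. z n i \<noteq> 0}"
    "\<And>m n i. m \<noteq> n \<Longrightarrow> z m i = 0 \<or> z n i = 0"
    "\<And>n. mass (z n) = 1"
    "\<And>n. pnorm p (\<lambda>i. x n i - z n i) \<le> \<delta> / 2 ^ Suc n"
    "\<And>n w. \<bar>total (window w) (z n) - \<mu> w\<bar> \<le> 1 / (2 * real M)"
    "\<And>w. (\<Sum>j<M. \<mu> (w + int j)) = 1"
proof -
  have pos: "0 < \<delta> / 2 ^ Suc n" for n
    using assms(3) by simp
  obtain x z where xz: "\<And>n. x n \<in> X" "\<And>n. finite {i. z n i \<noteq> 0}"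
    "\<And>m n i. m \<noteq> n \<Longrightarrow> z m i = 0 \<or> z n i = 0" "\<And>n. mass (z n) = 1"
    "\<And>n. pnorm p (\<lambda>i. x n i - z n i) \<le> \<delta> / 2 ^ Suc n"
    using almost_block_sequence[OF p assms(1,2), where \<epsilon> = "\<lambda>n. \<delta> / 2 ^ Suc n", OF pos] by blast
  define code where "code n = map (\<lambda>j. \<lfloor>2 * real M * total (window (int j)) (z n)\<rfloor>) [0..<M]" for n
  have "code n \<in> {l. set l \<subseteq> {0..2 * int M} \<and> length l = M}" for n
  proof -
    have "\<lfloor>2 * real M * total (window (int j)) (z n)\<rfloor> \<in> {0..2 * int M}" for j
    proof -
      have "2 * real M * total (window (int j)) (z n) \<le> 2 * real M * 1"
        using total_window_le_mass[of "int j" "z n"] xz(4) by (intro mult_left_mono) auto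
      then have "\<lfloor>2 * real M * total (window (int j)) (z n)\<rfloor> \<le> 2 * int M"
        by linarith
      then show ?thesis
        using total_window_nonneg by simp
    qed
    then show ?thesis by (auto simp: code_def)
  qed
  then have "finite (range code)"
    by (intro finite_subset[OF _ finite_lists_length_eq[of "{0..2 * int M}" M]]) auto
  then obtain n0 where inf: "infinite {n. code n = code n0}"
    using pigeonhole_infinite[of UNIV code] by auto
  define I where "I = {n. code n = code n0}"
  define e where "e = enumerate I"
  have "infinite I" using inf by (simp add: I_def)
  then have e: "strict_mono e" "e n \<in> I" for n
    unfolding e_def by (rule strict_mono_enumerate, rule enumerate_in_set)
  have close: "\<bar>total (window w) (z (e n)) - total (window w) (z n0)\<bar> \<le> 1 / (2 * real M)" for w n
  proof -
    have M: "0 < int M" using M_bounds by simp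
    define j where "j = nat (w mod int M)"
    have j: "j < M" "window w = window (int j)"
    proof -
      have "int j = w mod int M" using M by (simp add: j_def)
      then show "window w = window (int j)"
        by (intro window_mod_cong) simp
      show "j < M" using M by (simp add: j_def nat_less_iff)
    qed
    have "code (e n) ! j = code n0 ! j"
      using e(2)[of n] by (simp add: I_def)
    then have "\<lfloor>2 * real M * total (window w) (z (e n))\<rfloor> = \<lfloor>2 * real M * total (window w) (z n0)\<rfloor>"
      using j by (simp add: code_def)
    then have "\<bar>2 * real M * total (window w) (z (e n)) - 2 * real M * total (window w) (z n0)\<bar> \<le> 1"
      by linarith
    then have "\<bar>2 * real M * (total (window w) (z (e n)) - total (window w) (z n0))\<bar> \<le> 1"
      by (simp only: right_diff_distrib)
    then have "2 * real M * \<bar>total (window w) (z (e n)) - total (window w) (z n0)\<bar> \<le> 1"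
      by (simp only: abs_mult abs_numeral abs_of_nat)
    then show ?thesis
      using M by (simp add: pos_le_divide_eq mult.commute)
  qed
  show ?thesis
  proof (rule that)
    show "z (e m) i = 0 \<or> z (e n) i = 0" if "m \<noteq> n" for m n i
      using xz(3) that strict_mono_eq[OF e(1)] by auto
    show "pnorm p (\<lambda>i. x (e n) i - z (e n) i) \<le> \<delta> / 2 ^ Suc n" for n
    proof -
      \<comment> \<open>Passing to a subsequence only tightens the tolerance, because
        \<open>e n \<ge> n\<close>.\<close>
      have "\<delta> / 2 ^ Suc (e n) \<le> \<delta> / 2 ^ Suc n"
        using assms(3) strict_mono_imp_increasing[OF e(1), of n]
        by (intro divide_left_mono power_increasing) auto
      then show ?thesis using xz(5)[of "e n"] by linarith
    qed
    \<comment> \<open>The profile \<open>\<mu>\<close> is that of one actual block, so its sum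
      around the circle is exactly 1.\<close>
    show "(\<Sum>j<M. total (window (w + int j)) (z n0)) = 1" for w
      by (simp add: sum_total_window xz)
    show "x (e n) \<in> X" "finite {i. z (e n) i \<noteq> 0}" "mass (z (e n)) = 1" for n
      by (rule xz)+
    show "\<bar>total (window w) (z (e n)) - total (window w) (z n0)\<bar> \<le> 1 / (2 * real M)" for n w
      by (rule close)
  qed
qed

text \<open>The exponents \<open>a l\<close> take each value \<open>j < M\<close> about \<open>\<beta>\<^sup>j\<close> times, so that the weights
  \<open>\<beta> powr - a l\<close> give each rotation by \<open>j\<close> windows a total mass between 1 and 2.\<close>

lemma rotation_exponents:
  obtains Q :: nat and s :: "nat \<Rightarrow> real" and a :: "nat \<Rightarrow> nat" where
    "1 \<le> Q" "\<And>j. 1 \<le> s j" "\<And>j. s j \<le> 2"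
    "\<And>f. (\<Sum>l<Q. \<beta> powr - real (a l) * f (a l)) = (\<Sum>j<M. s j * f j)"
proof -
  define c where "c j = nat \<lceil>\<beta> powr real j\<rceil>" for j :: nat
  have ge1: "1 \<le> \<beta> powr real j" for j :: nat
    using beta_bounds by (simp add: ge_one_powr_ge_zero)
  have c: "\<beta> powr real j \<le> real (c j)" "real (c j) \<le> 2 * \<beta> powr real j" for j
    using ge1[of j] unfolding c_def by linarith+
  define D where "D = Sigma {..<M} (\<lambda>j. {..<c j})"
  define Q where "Q = card D"
  have D: "finite D" by (simp add: D_def)
  then obtain \<phi> where \<phi>: "bij_betw \<phi> {..<Q} D"
    using ex_bij_betw_nat_finite[of D] by (auto simp: Q_def atLeast0LessThan)
  define s where "s j = real (c j) * \<beta> powr - real j" for j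
  show ?thesis
  proof (rule that[of Q s "\<lambda>l. fst (\<phi> l)"])
    have "0 < c 0" using c(1)[of 0] beta_bounds by simp
    then have "(0, 0) \<in> D"
      using M_bounds by (auto simp: D_def)
    then show "1 \<le> Q"
      using D by (auto simp: Q_def Suc_le_eq card_gt_0_iff)
    show "1 \<le> s j" "s j \<le> 2" for j
      using c[of j] beta_bounds by (simp_all add: s_def powr_minus_divide divide_simps)
    fix f :: "nat \<Rightarrow> real"
    have "(\<Sum>l<Q. \<beta> powr - real (fst (\<phi> l)) * f (fst (\<phi> l)))
        = (\<Sum>d\<in>D. \<beta> powr - real (fst d) * f (fst d))"
      by (rule sum.reindex_bij_betw[OF \<phi>])
    also have "\<dots> = (\<Sum>j<M. \<Sum>i<c j. \<beta> powr - real j * f j)"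
      unfolding D_def by (subst sum.Sigma) (auto simp: case_prod_unfold)
    also have "\<dots> = (\<Sum>j<M. s j * f j)"
      by (simp add: s_def mult.assoc)
    finally show "(\<Sum>l<Q. \<beta> powr - real (fst (\<phi> l)) * f (fst (\<phi> l))) = (\<Sum>j<M. s j * f j)" .
  qed
qed

text \<open>The factor \<open>\<beta> powr (- a l / p)\<close> rotates the windows of
  \<open>z l\<close> by \<open>a l\<close> and scales the mass to \<open>\<beta> powr - a l\<close>.
  Grouped by rotation, each window collects the whole profile with weights between 1 and 2: its mass
  lies between 1/2 and 3, while the total mass lies between \<open>M\<close> and
  \<open>2 * M\<close>.\<close>

lemma flat_rotation_sum:
  fixes z :: "nat \<Rightarrow> nat \<Rightarrow> real"
  assumes "\<And>l. l < Q \<Longrightarrow> finite {i. z l i \<noteq> 0}"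
    and "\<And>l m i. l < Q \<Longrightarrow> m < Q \<Longrightarrow> l \<noteq> m \<Longrightarrow> z l i = 0 \<or> z m i = 0"
    and "\<And>l. l < Q \<Longrightarrow> mass (z l) = 1"
    and \<mu>: "\<And>l w. l < Q \<Longrightarrow> \<bar>total (window w) (z l) - \<mu> w\<bar> \<le> 1 / (2 * real M)"
      "\<And>w. (\<Sum>j<M. \<mu> (w + int j)) = 1"
    and s: "\<And>j. 1 \<le> s j" "\<And>j. s j \<le> 2"
      "\<And>f. (\<Sum>l<Q. \<beta> powr - real (a l) * f (a l)) = (\<Sum>j<M. s j * f j)"
  defines "u \<equiv> \<lambda>i. \<Sum>l<Q. \<beta> powr (- real (a l) / p) * z l i"
  shows "flat u" "1 \<le> mass u"
proof -
  define d where "d l = \<beta> powr (- real (a l) / p)" for l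
  have d: "d l \<noteq> 0" "\<bar>d l\<bar> powr p = \<beta> powr - real (a l)" for l
    using beta_bounds p by (auto simp: d_def powr_powr)
  have u: "u = (\<lambda>i. \<Sum>l<Q. d l * z l i)"
    by (simp add: u_def d_def)
  have fin: "finite {i. d l * z l i \<noteq> 0}" if "l < Q" for l
    using assms(1)[OF that] d(1) by simp
  have disj: "d l * z l i = 0 \<or> d m * z m i = 0" if "l < Q" "m < Q" "l \<noteq> m" for l m i
    using assms(2)[OF that] by auto
  have "mass u = (\<Sum>l<Q. mass (\<lambda>i. d l * z l i))"
    unfolding u using fin disj by (intro total_sum_disjoint) auto
  also have "\<dots> = (\<Sum>l<Q. \<beta> powr - real (a l) * 1)"
    by (intro sum.cong) (auto simp: mass_scale d assms(3))
  also have "\<dots> = (\<Sum>j<M. s j * 1)"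
    by (rule s(3))
  finally have mass_u: "mass u = (\<Sum>j<M. s j)" by simp
  have "(\<Sum>j<M. 1) \<le> (\<Sum>j<M. s j)" "(\<Sum>j<M. s j) \<le> (\<Sum>j<M. 2)"
    by (intro sum_mono s)+
  then have m: "real M \<le> mass u" "mass u \<le> 2 * real M"
    by (auto simp: mass_u)
  then show "1 \<le> mass u"
    using M_bounds by linarith
  have W: "total (window w) u = (\<Sum>l<Q. \<beta> powr - real (a l) * total (window (w + int (a l))) (z l))" for w
  proof -
    have "total (window w) u = (\<Sum>l<Q. total (window w) (\<lambda>i. d l * z l i))"
      unfolding u using fin disj by (intro total_sum_disjoint) auto
    then show ?thesis
      using d by (simp add: total_scale window_shift total_mult)
  qed
  define h where "h = 1 / (2 * real M)"
  have h: "0 \<le> h" "real M * h = 1 / 2"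
    using M_bounds by (auto simp: h_def)
  have close: "total (window w) (z l) \<le> \<mu> w + h" "\<mu> w - h \<le> total (window w) (z l)" if "l < Q" for l w
    using \<mu>(1)[OF that, of w] by (auto simp: h_def)
  \<comment> \<open>A block must exist to see that \<open>\<mu> w + h\<close> is nonnegative;
    \<open>Q = 0\<close> would force the sum of the \<open>s j\<close> to vanish.\<close>
  have "0 < Q"
  proof (rule ccontr)
    assume "\<not> 0 < Q"
    then show False
      using s(3)[of "\<lambda>_. 1"] m M_bounds mass_u by simp
  qed
  have \<mu>_h: "0 \<le> \<mu> w + h" for w
    using close(1)[OF \<open>0 < Q\<close>, of w] total_window_nonneg[of w "z 0"] by linarith
  show "flat u"
    unfolding flat_def
  proof (intro allI conjI)
    fix w
    have "total (window w) u \<le> (\<Sum>l<Q. \<beta> powr - real (a l) * (\<mu> (w + int (a l)) + h))"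
      unfolding W by (intro sum_mono mult_left_mono close) auto
    also have "\<dots> = (\<Sum>j<M. s j * (\<mu> (w + int j) + h))"
      by (rule s(3))
    also have "\<dots> \<le> (\<Sum>j<M. 2 * (\<mu> (w + int j) + h))"
      using \<mu>_h by (intro sum_mono mult_right_mono s) auto
    \<comment> \<open>Twice the sum of the profile, 1, and of the errors,
      \<open>M * h = 1 / 2\<close>.\<close>
    also have "\<dots> = 3"
      using h(2) by (simp add: sum_distrib_left[symmetric] sum.distrib \<mu>(2))
    also have "\<dots> \<le> 3 * mass u / real M"
      using m M_bounds by (simp add: divide_simps)
    finally show "total (window w) u \<le> 3 * mass u / real M" .
    have "mass u / (4 * real M) \<le> 1 / 2"
      using m M_bounds by (simp add: divide_simps)
    also have "1 / 2 = (\<Sum>j<M. \<mu> (w + int j) - h)"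
      using h(2) by (simp add: sum_subtractf \<mu>(2))
    \<comment> \<open>The profile minus the error may be negative, and then the factor
      \<open>s j \<ge> 1\<close> would go the wrong way. Truncation at 0 repairs this and stays
      below the window masses, which are nonnegative.\<close>
    also have "\<dots> \<le> (\<Sum>j<M. s j * max 0 (\<mu> (w + int j) - h))"
    proof (rule sum_mono)
      fix j
      have "\<mu> (w + int j) - h \<le> 1 * max 0 (\<mu> (w + int j) - h)"
        by simp
      also have "\<dots> \<le> s j * max 0 (\<mu> (w + int j) - h)"
        using s(1) by (intro mult_right_mono) auto
      finally show "\<mu> (w + int j) - h \<le> s j * max 0 (\<mu> (w + int j) - h)" .
    qed
    also have "\<dots> = (\<Sum>l<Q. \<beta> powr - real (a l) * max 0 (\<mu> (w + int (a l)) - h))"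
      by (rule s(3)[symmetric])
    also have "\<dots> \<le> total (window w) u"
      unfolding W using close total_window_nonneg by (intro sum_mono mult_left_mono) auto
    finally show "mass u / (4 * real M) \<le> total (window w) u" .
  qed
qed

text \<open>Consecutive groups of \<open>Q\<close> almost equidistributed blocks, with indices
  \<open>m * Q + l\<close>, are combined with the rotation weights.\<close>

lemma almost_flat_blocks:
  assumes "closed_subspace_lp p X" "infinite_dim X" "0 < \<delta>"
  obtains u v where "\<And>m. u m \<in> X" "\<And>m. finite {i. v m i \<noteq> 0}"
    "\<And>m n i. m \<noteq> n \<Longrightarrow> v m i = 0 \<or> v n i = 0"
    "\<And>m. flat (v m)" "\<And>m. 1 \<le> mass (v m)"
    "\<And>m. pnorm p (\<lambda>i. u m i - v m i) \<le> \<delta> / 2 ^ Suc m"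
proof -
  obtain Q :: nat and s :: "nat \<Rightarrow> real" and a :: "nat \<Rightarrow> nat" where
    Q: "1 \<le> Q" and s: "\<And>j. 1 \<le> s j" "\<And>j. s j \<le> 2"
      "\<And>f. (\<Sum>l<Q. \<beta> powr - real (a l) * f (a l)) = (\<Sum>j<M. s j * f j)"
    using rotation_exponents by blast
  \<comment> \<open>Each new block is a sum of \<open>Q\<close> old ones with coefficients at most
    1, so the old tolerance is divided by \<open>Q\<close>.\<close>
  have "0 < \<delta> / real Q"
    using assms(3) Q by simp
  obtain x z \<mu> where xz: "\<And>n. x n \<in> X" "\<And>n. finite {i. z n i \<noteq> 0}"
    "\<And>m n i. m \<noteq> n \<Longrightarrow> z m i = 0 \<or> z n i = 0"
    "\<And>n. mass (z n) = 1"
    "\<And>n. pnorm p (\<lambda>i. x n i - z n i) \<le> \<delta> / real Q / 2 ^ Suc n"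
    "\<And>n w. \<bar>total (window w) (z n) - \<mu> w\<bar> \<le> 1 / (2 * real M)"
    "\<And>w. (\<Sum>j<M. \<mu> (w + int j)) = 1"
    using almost_equidistributed_sequence[OF assms(1,2) \<open>0 < \<delta> / real Q\<close>] by blast
  define d where "d l = \<beta> powr (- real (a l) / p)" for l
  have d: "0 \<le> d l" "d l \<le> 1" for l
    using beta_bounds p powr_mono[of "- real (a l) / p" 0 \<beta>] by (auto simp: d_def)
  define u where "u m = (\<lambda>i. \<Sum>l<Q. d l * x (m * Q + l) i)" for m
  define v where "v m = (\<lambda>i. \<Sum>l<Q. d l * z (m * Q + l) i)" for m
  have index_inj: "m * Q + l = n * Q + k \<longleftrightarrow> m = n \<and> l = k" if "l < Q" "k < Q" for m n l k
  proof -
    have "(m * Q + l) div Q = m" "(m * Q + l) mod Q = l" "(n * Q + k) div Q = n" "(n * Q + k) mod Q = k"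
      using that by auto
    then show ?thesis by metis
  qed
  show ?thesis
  proof (rule that)
    show "u m \<in> X" for m
      unfolding u_def using xz by (intro closed_subspace_sum[OF assms(1)]) auto
    show "finite {i. v m i \<noteq> 0}" for m
      unfolding v_def
    proof (rule finite_support_sum)
      show "finite {i. d l * z (m * Q + l) i \<noteq> 0}" for l
        by (rule finite_subset[OF _ xz(2)[of "m * Q + l"]]) auto
    qed simp
    show "v m i = 0 \<or> v n i = 0" if "m \<noteq> n" for m n i
    proof (rule ccontr)
      have nonzero: "\<exists>l<Q. z (m * Q + l) i \<noteq> 0" if "v m i \<noteq> 0" for m
      proof (rule ccontr)
        assume "\<not> (\<exists>l<Q. z (m * Q + l) i \<noteq> 0)"
        then have "v m i = 0"
          unfolding v_def by (intro sum.neutral) auto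
        with that show False by simp
      qed
      assume "\<not> (v m i = 0 \<or> v n i = 0)"
      then obtain l k where "l < Q" "k < Q" "z (m * Q + l) i \<noteq> 0" "z (n * Q + k) i \<noteq> 0"
        using nonzero by blast
      then show False
        using xz(3)[of "m * Q + l" "n * Q + k" i] index_inj that by auto
    qed
    show "flat (v m)" "1 \<le> mass (v m)" for m
    proof -
      have disj: "z (m * Q + l) i = 0 \<or> z (m * Q + k) i = 0" if "l \<noteq> k" for l k i
        using xz(3) that by auto
      show "flat (v m)" "1 \<le> mass (v m)"
        unfolding v_def d_def
        by (rule flat_rotation_sum[of Q "\<lambda>l. z (m * Q + l)" \<mu> s a]; (rule disj xz s; assumption))+
    qed
    show "pnorm p (\<lambda>i. u m i - v m i) \<le> \<delta> / 2 ^ Suc m" for m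
    proof -
      have lp: "(\<lambda>i. x n i - z n i) \<in> lp p" for n
        using lp_diff[OF _ _ lp_finite_support[OF xz(2)]] closed_subspace_lpD(1)[OF assms(1) xz(1)] p by simp
      have "pnorm p (\<lambda>i. u m i - v m i)
          = pnorm p (\<lambda>i. \<Sum>l<Q. d l * (x (m * Q + l) i - z (m * Q + l) i))"
        by (simp add: u_def v_def sum_subtractf right_diff_distrib)
      also have "\<dots> \<le> (\<Sum>l<Q. pnorm p (\<lambda>i. d l * (x (m * Q + l) i - z (m * Q + l) i)))"
        using p lp lp_scale by (intro pnorm_sum) auto
      also have "\<dots> \<le> (\<Sum>l<Q. \<delta> / real Q / 2 ^ Suc m)"
      proof (rule sum_mono)
        fix l
        have "pnorm p (\<lambda>i. d l * (x (m * Q + l) i - z (m * Q + l) i))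
            = d l * pnorm p (\<lambda>i. x (m * Q + l) i - z (m * Q + l) i)"
          using pnorm_scale[OF _ lp] p d by simp
        also have "\<dots> \<le> 1 * (\<delta> / real Q / 2 ^ Suc (m * Q + l))"
          using d xz(5) by (intro mult_mono) (auto simp: pnorm_nonneg)
        also have "\<dots> \<le> \<delta> / real Q / 2 ^ Suc m"
        proof -
          have "m * 1 \<le> m * Q + l"
            using Q by (intro trans_le_add1 mult_le_mono2)
          then have "(2::real) ^ Suc m \<le> 2 ^ Suc (m * Q + l)"
            by (intro power_increasing) auto
          then show ?thesis
            using assms(3) by (simp only: mult_1) (intro divide_left_mono, auto)
        qed
        finally show "pnorm p (\<lambda>i. d l * (x (m * Q + l) i - z (m * Q + l) i)) \<le> \<delta> / real Q / 2 ^ Suc m" .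
      qed
      also have "\<dots> = \<delta> / 2 ^ Suc m"
        using Q by simp
      finally show ?thesis .
    qed
  qed
qed

end

section \<open>Closed spans of almost flat blocks\<close>

definition lp_closure :: "real \<Rightarrow> (nat \<Rightarrow> real) set \<Rightarrow> (nat \<Rightarrow> real) set" where
  "lp_closure p V = {x \<in> lp p. \<forall>\<epsilon>>0. \<exists>v\<in>V. pnorm p (\<lambda>i. x i - v i) < \<epsilon>}"

lemma lp_closureD:
  assumes "x \<in> lp_closure p V"
  shows "x \<in> lp p" "0 < \<epsilon> \<Longrightarrow> \<exists>v\<in>V. pnorm p (\<lambda>i. x i - v i) < \<epsilon>"
  using assms by (auto simp: lp_closure_def)

lemma lp_closure_superset: "V \<subseteq> lp p \<Longrightarrow> V \<subseteq> lp_closure p V"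
  by (auto simp: lp_closure_def pnorm_zero intro!: bexI)

lemma lp_closure_subset:
  assumes "closed_subspace_lp p X" "V \<subseteq> X"
  shows "lp_closure p V \<subseteq> X"
proof
  fix x assume x: "x \<in> lp_closure p V"
  have "\<exists>v\<in>V. pnorm p (\<lambda>i. x i - v i) < inverse (real (Suc n))" for n
    using lp_closureD(2)[OF x] by simp
  then obtain s where s: "\<And>n. s n \<in> V" "\<And>n. pnorm p (\<lambda>i. x i - s n i) < inverse (real (Suc n))"
    by metis
  have "(\<lambda>n. pnorm p (\<lambda>i. x i - s n i)) \<longlonglongrightarrow> 0"
    by (rule tendsto_sandwich[OF _ _ tendsto_const LIMSEQ_inverse_real_of_nat])
      (auto intro!: always_eventually less_imp_le[OF s(2)] simp: pnorm_nonneg simp del: of_nat_Suc)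
  moreover have "(\<lambda>n. pnorm p (\<lambda>i. s n i - x i)) = (\<lambda>n. pnorm p (\<lambda>i. x i - s n i))"
    by (rule ext, rule pnorm_minus_commute)
  ultimately have lim: "(\<lambda>n. pnorm p (\<lambda>i. s n i - x i)) \<longlonglongrightarrow> 0"
    by simp
  have "s n \<in> X" for n
    using s(1) assms(2) by blast
  then show "x \<in> X"
    by (rule closed_subspace_lpD(5)[OF assms(1) _ lp_closureD(1)[OF x] lim])
qed

lemma closed_subspace_lp_closure:
  assumes "1 \<le> p" "V \<subseteq> lp p" "(\<lambda>i. 0) \<in> V"
    and add: "\<And>x y. x \<in> V \<Longrightarrow> y \<in> V \<Longrightarrow> (\<lambda>i. x i + y i) \<in> V"
    and scale: "\<And>c x. x \<in> V \<Longrightarrow> (\<lambda>i. c * x i) \<in> V"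
  shows "closed_subspace_lp p (lp_closure p V)"
proof -
  have V_lp: "v \<in> lp p" if "v \<in> V" for v
    using assms(2) that by blast
  have "(\<lambda>i. x i + y i) \<in> lp_closure p V" if x: "x \<in> lp_closure p V" and y: "y \<in> lp_closure p V" for x y
    unfolding lp_closure_def
  proof (intro CollectI conjI allI impI)
    show "(\<lambda>i. x i + y i) \<in> lp p"
      using assms(1) lp_closureD(1)[OF x] lp_closureD(1)[OF y] by (rule lp_add)
    fix \<epsilon> :: real assume "0 < \<epsilon>"
    then obtain v w where v: "v \<in> V" "pnorm p (\<lambda>i. x i - v i) < \<epsilon> / 2"
      and w: "w \<in> V" "pnorm p (\<lambda>i. y i - w i) < \<epsilon> / 2"
      using lp_closureD(2)[OF x, of "\<epsilon> / 2"] lp_closureD(2)[OF y, of "\<epsilon> / 2"] by auto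
    have "pnorm p (\<lambda>i. (x i - v i) + (y i - w i)) \<le> pnorm p (\<lambda>i. x i - v i) + pnorm p (\<lambda>i. y i - w i)"
      using assms(1) v w lp_closureD(1)[OF x] lp_closureD(1)[OF y] V_lp
      by (intro pnorm_triangle lp_diff) auto
    also have "\<dots> < \<epsilon>" using v w by simp
    finally have "pnorm p (\<lambda>i. x i + y i - (v i + w i)) < \<epsilon>"
      by (simp add: algebra_simps)
    then show "\<exists>v\<in>V. pnorm p (\<lambda>i. x i + y i - v i) < \<epsilon>"
      using add[OF v(1) w(1)] by (rule rev_bexI[rotated])
  qed
  moreover have "(\<lambda>i. c * x i) \<in> lp_closure p V" if x: "x \<in> lp_closure p V" for c x
    unfolding lp_closure_def
  proof (intro CollectI conjI allI impI)
    show "(\<lambda>i. c * x i) \<in> lp p"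
      using lp_closureD(1)[OF x] by (rule lp_scale)
    fix \<epsilon> :: real assume \<epsilon>: "0 < \<epsilon>"
    then obtain v where v: "v \<in> V" "pnorm p (\<lambda>i. x i - v i) < \<epsilon> / (\<bar>c\<bar> + 1)"
      using lp_closureD(2)[OF x, of "\<epsilon> / (\<bar>c\<bar> + 1)"] by auto
    have "pnorm p (\<lambda>i. c * (x i - v i)) = \<bar>c\<bar> * pnorm p (\<lambda>i. x i - v i)"
      using assms(1) v lp_closureD(1)[OF x] V_lp by (intro pnorm_scale lp_diff) auto
    also have "\<dots> \<le> \<bar>c\<bar> * (\<epsilon> / (\<bar>c\<bar> + 1))"
      using v by (intro mult_left_mono) auto
    also have "\<dots> < \<epsilon>"
      using \<epsilon> by (simp add: divide_simps distrib_left)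
    finally have "pnorm p (\<lambda>i. c * x i - c * v i) < \<epsilon>"
      by (simp add: right_diff_distrib)
    then show "\<exists>v\<in>V. pnorm p (\<lambda>i. c * x i - v i) < \<epsilon>"
      using scale[OF v(1)] by (rule rev_bexI[rotated])
  qed
  moreover have "x \<in> lp_closure p V"
    if s: "\<And>n. s n \<in> lp_closure p V" "x \<in> lp p" "(\<lambda>n. pnorm p (\<lambda>i. s n i - x i)) \<longlonglongrightarrow> 0" for s x
    unfolding lp_closure_def
  proof (intro CollectI conjI allI impI s(2))
    fix \<epsilon> :: real assume \<epsilon>: "0 < \<epsilon>"
    then obtain n where n: "pnorm p (\<lambda>i. s n i - x i) < \<epsilon> / 2"
      using LIMSEQ_D[OF s(3), of "\<epsilon> / 2"] by (auto simp: pnorm_nonneg)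
    obtain v where v: "v \<in> V" "pnorm p (\<lambda>i. s n i - v i) < \<epsilon> / 2"
      using lp_closureD(2)[OF s(1), of "\<epsilon> / 2" n] \<epsilon> by auto
    have "pnorm p (\<lambda>i. (x i - s n i) + (s n i - v i)) \<le> pnorm p (\<lambda>i. x i - s n i) + pnorm p (\<lambda>i. s n i - v i)"
      using assms(1) v s(2) lp_closureD(1)[OF s(1)] V_lp by (intro pnorm_triangle lp_diff) auto
    also have "\<dots> < \<epsilon>"
      using n v by (simp add: pnorm_minus_commute[of p x])
    finally show "\<exists>v\<in>V. pnorm p (\<lambda>i. x i - v i) < \<epsilon>"
      using v(1) by (intro bexI[of _ v]) simp_all
  qed
  moreover have "(\<lambda>i. 0) \<in> lp_closure p V"
    using lp_closure_superset[OF assms(2)] assms(3) by blast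
  ultimately show ?thesis
    unfolding closed_subspace_lp_def using lp_closureD(1) by blast
qed

text \<open>Both signs of a unit vector belong to the norming set, so the norm bounds a coordinate
  and its negative.\<close>

lemma tnorm_nonneg:
  assumes "1 < p" "1 < q" "1 / p + 1 / q = 1" "0 < r" "x \<in> lp p"
  shows "0 \<le> tnorm q r x"
proof -
  have "{k. unitvec 0 k \<noteq> 0} = {0}"
    by (auto simp: unitvec_def)
  then have "pairing x (unitvec 0) = x 0" "pairing x (\<lambda>i. - unitvec 0 i) = - x 0"
    by (auto simp: pairing_def unitvec_def)
  then have "x 0 \<le> tnorm q r x" "- x 0 \<le> tnorm q r x"
    using pairing_le_tnorm[OF assms KM.unit_pos[of 0]] pairing_le_tnorm[OF assms KM.unit_neg[of 0]] by auto
  then show ?thesis by linarith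
qed

text \<open>Combinations run over initial segments, so that two of them are brought to a common
  length by zero coefficients.\<close>

definition finite_span :: "(nat \<Rightarrow> nat \<Rightarrow> real) \<Rightarrow> (nat \<Rightarrow> real) set" where
  "finite_span u = {\<lambda>i. \<Sum>m<T. t m * u m i | t T. True}"

lemma finite_spanI: "(\<lambda>i. \<Sum>m<T. t m * u m i) \<in> finite_span u"
  unfolding finite_span_def by blast

lemma finite_span_zero: "(\<lambda>i. 0) \<in> finite_span u"
  using finite_spanI[where T = 0] by simp

lemma finite_span_scale:
  assumes "x \<in> finite_span u"
  shows "(\<lambda>i. c * x i) \<in> finite_span u"
proof -
  obtain t and T :: nat where "x = (\<lambda>i. \<Sum>m<T. t m * u m i)"
    using assms by (auto simp: finite_span_def)
  then have "(\<lambda>i. c * x i) = (\<lambda>i. \<Sum>m<T. (c * t m) * u m i)"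
    by (simp add: sum_distrib_left mult.assoc)
  then show ?thesis
    by (simp only: finite_spanI)
qed

lemma finite_span_add:
  assumes "x \<in> finite_span u" "y \<in> finite_span u"
  shows "(\<lambda>i. x i + y i) \<in> finite_span u"
proof -
  obtain t s and T S :: nat where x: "x = (\<lambda>i. \<Sum>m<T. t m * u m i)" and y: "y = (\<lambda>i. \<Sum>m<S. s m * u m i)"
    using assms unfolding finite_span_def by blast
  have pad: "(\<Sum>m<R. t m * u m i) = (\<Sum>m<N. (if m < R then t m else 0) * u m i)" if "R \<le> N" for t :: "nat \<Rightarrow> real" and R N i
    using that by (intro sum.mono_neutral_cong_left) auto
  have "(\<lambda>i. x i + y i) = (\<lambda>i. \<Sum>m<max T S. ((if m < T then t m else 0) + (if m < S then s m else 0)) * u m i)"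
    unfolding x y by (subst pad[of T "max T S"], simp, subst pad[of S "max T S"], simp)
      (simp only: sum.distrib[symmetric] distrib_right)
  then show ?thesis
    by (simp only: finite_spanI)
qed

section \<open>Norm equivalence on the span and its closure\<close>

context conjugate_exponents
begin

text \<open>This replaces \<open>M\<close> by \<open>log 2 r\<close> in the two estimates: their
  ratio lies between 1/2 and 1, hence so does its power \<open>R\<close>, and 768 doubles to 1536.
  Mass zero is treated apart, as the estimates assume positive mass.\<close>

lemma tnorm_spread:
  assumes "spread z" "finite {i. z i \<noteq> 0}"
  shows "pnorm p z / 1536 \<le> log 2 (real r) powr (1 / p) * tnorm q r z"
    and "log 2 (real r) powr (1 / p) * tnorm q r z \<le> 26 * q * pnorm p z"
proof -
  define C where "C = log 2 (real r) powr (1 / p)"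
  have lp: "z \<in> lp p"
    by (rule lp_finite_support[OF assms(2)])
  have "pnorm p z / 1536 \<le> C * tnorm q r z \<and> C * tnorm q r z \<le> 26 * q * pnorm p z"
  proof (cases "0 < mass z")
    case False
    then have "pnorm p z = 0"
      using mass_nonneg[of z] pnorm_eq_mass[OF assms(2)] p by simp
    moreover have "tnorm q r z \<le> pnorm p z"
      using pairing_le_pnorm[OF p q pq, of r z] lp r by (intro tnorm_leI) auto
    moreover have "0 \<le> tnorm q r z"
      using tnorm_nonneg[OF p q pq _ lp] r by simp
    ultimately show ?thesis by simp
  next
    case True
    define n where "n = (mass z / real M) powr (1 / p)"
    define R where "R = (log 2 (real r) / real M) powr (1 / p)"
    have Cn: "C * n = R * pnorm p z"
      using True M_bounds log_r_ge_1 pnorm_eq_mass[OF assms(2)]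
      by (simp add: C_def n_def R_def powr_mult powr_divide)
    have ratio: "1 / 2 \<le> log 2 (real r) / real M" "log 2 (real r) / real M \<le> 1"
      using M_bounds by (auto simp: field_simps)
    have "(1 / 2) powr 1 \<le> (1 / 2 :: real) powr (1 / p)"
      using p by (intro powr_mono') auto
    also have "\<dots> \<le> R"
      unfolding R_def using ratio p by (intro powr_mono2) auto
    finally have R: "1 / 2 \<le> R" by simp
    have "R \<le> 1"
      unfolding R_def using ratio p log_r_ge_1 by (intro powr_le1) auto
    then have upper: "R * pnorm p z \<le> pnorm p z"
      using pnorm_nonneg by (intro mult_left_le_one_le) (use R in auto)
    have lower: "1 / 2 * pnorm p z \<le> R * pnorm p z"
      using R pnorm_nonneg by (rule mult_right_mono)
    have "C * (n / 768) \<le> C * tnorm q r z"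
      using tnorm_spread_lower[OF assms True] by (intro mult_left_mono) (auto simp: n_def C_def)
    moreover have "C * tnorm q r z \<le> C * (26 * q * n)"
      using tnorm_spread_upper[OF assms True] by (intro mult_left_mono) (auto simp: n_def C_def)
    moreover have "C * (26 * q * n) \<le> 26 * q * pnorm p z"
      using upper q by (simp add: Cn mult.left_commute[of C])
    ultimately show ?thesis
      using Cn lower by simp
  qed
  then show "pnorm p z / 1536 \<le> log 2 (real r) powr (1 / p) * tnorm q r z"
    and "log 2 (real r) powr (1 / p) * tnorm q r z \<le> 26 * q * pnorm p z"
    by (auto simp: C_def)
qed

text \<open>Disjoint blocks of mass at least 1 bound each coefficient by the norm of
  \<open>z\<close>. As the tolerances sum to at most \<open>\<delta>\<close>, the error is small
  relative to that norm, whatever the coefficients.\<close>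

lemma block_combination:
  fixes u v :: "nat \<Rightarrow> nat \<Rightarrow> real" and t :: "nat \<Rightarrow> real" and T :: nat
  assumes "\<And>m. u m \<in> lp p" "\<And>m. finite {i. v m i \<noteq> 0}"
    "\<And>m n i. m \<noteq> n \<Longrightarrow> v m i = 0 \<or> v n i = 0"
    "\<And>m. flat (v m)" "\<And>m. 1 \<le> mass (v m)" "0 < \<delta>"
    "\<And>m. pnorm p (\<lambda>i. u m i - v m i) \<le> \<delta> / 2 ^ Suc m"
  defines "z \<equiv> \<lambda>i. \<Sum>m<T. t m * v m i" and "y \<equiv> \<lambda>i. \<Sum>m<T. t m * u m i"
  shows "spread z" "finite {i. z i \<noteq> 0}" "y \<in> lp p"
    and "\<And>m. m < T \<Longrightarrow> \<bar>t m\<bar> \<le> pnorm p z"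
    and "pnorm p (\<lambda>i. y i - z i) \<le> \<delta> * pnorm p z"
proof -
  have fin: "finite {i. t m * v m i \<noteq> 0}" for m
    by (rule finite_subset[OF _ assms(2)[of m]]) auto
  have disj: "t m * v m i = 0 \<or> t n * v n i = 0" if "m \<noteq> n" for m n i
    using assms(3)[OF that, of i] by auto
  show "spread z"
    unfolding z_def using fin disj assms(4) by (intro spread_sum spread_scale) auto
  show z_fin: "finite {i. z i \<noteq> 0}"
    unfolding z_def using fin by (intro finite_support_sum) auto
  show "y \<in> lp p"
    unfolding y_def using p assms(1) lp_scale by (intro lp_sum) auto
  have mass_z: "mass z = (\<Sum>m<T. \<bar>t m\<bar> powr p * mass (v m))"
    unfolding z_def mass_scale[symmetric] using fin disj by (intro total_sum_disjoint) auto
  show t_le: "\<bar>t m\<bar> \<le> pnorm p z" if "m < T" for m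
  proof -
    have "\<bar>t m\<bar> powr p * 1 \<le> \<bar>t m\<bar> powr p * mass (v m)"
      by (intro mult_left_mono assms(5)) simp
    also have "\<dots> \<le> mass z"
      unfolding mass_z using that by (intro member_le_sum) (auto intro: mult_nonneg_nonneg mass_nonneg)
    finally have "(\<bar>t m\<bar> powr p) powr (1 / p) \<le> mass z powr (1 / p)"
      using p by (intro powr_mono2) auto
    then show ?thesis
      using p by (simp add: pnorm_eq_mass[OF z_fin] powr_powr)
  qed
  have lp: "(\<lambda>i. u m i - v m i) \<in> lp p" for m
    using p by (intro lp_diff assms(1) lp_finite_support[OF assms(2)]) auto
  have "pnorm p (\<lambda>i. y i - z i) = pnorm p (\<lambda>i. \<Sum>m<T. t m * (u m i - v m i))"
    by (simp add: y_def z_def sum_subtractf right_diff_distrib)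
  also have "\<dots> \<le> (\<Sum>m<T. pnorm p (\<lambda>i. t m * (u m i - v m i)))"
    using p lp lp_scale by (intro pnorm_sum) auto
  also have "\<dots> = (\<Sum>m<T. \<bar>t m\<bar> * pnorm p (\<lambda>i. u m i - v m i))"
    using p by (intro sum.cong pnorm_scale lp) auto
  also have "\<dots> \<le> (\<Sum>m<T. pnorm p z * (\<delta> / 2 ^ Suc m))"
    using t_le assms(7) by (intro sum_mono mult_mono) (auto simp: pnorm_nonneg)
  also have "\<dots> = \<delta> * pnorm p z * (\<Sum>m<T. (1 / 2) ^ Suc m)"
    unfolding sum_distrib_left by (intro sum.cong) (auto simp: power_divide)
  also have "\<dots> \<le> \<delta> * pnorm p z * 1"
  proof (rule mult_left_mono)
    have "(\<Sum>m<T. (1 / 2) ^ Suc m) = 1 - (1 / 2 :: real) ^ T"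
      by (induction T) auto
    then show "(\<Sum>m<T. (1 / 2) ^ Suc m :: real) \<le> 1" by simp
  qed (use assms(6) in \<open>simp add: pnorm_nonneg\<close>)
  finally show "pnorm p (\<lambda>i. y i - z i) \<le> \<delta> * pnorm p z" by simp
qed

text \<open>The subspace is the closed span of the almost flat vectors \<open>u m\<close>. On finite
  combinations the estimates come from nearby spread vectors, with room left for the perturbation,
  and then pass to limits.\<close>

lemma tnorm_equivalent_subspace:
  assumes X: "closed_subspace_lp p X" "infinite_dim X"
  shows "\<exists>Y. Y \<subseteq> X \<and> closed_subspace_lp p Y \<and> infinite_dim Y \<and>
    (\<forall>x\<in>Y. 4 powr (-6) * pnorm p x \<le> log 2 (real r) powr (1 / p) * tnorm q r x \<and>
      log 2 (real r) powr (1 / p) * tnorm q r x \<le> 3 * 4 ^ 7 * (p + q) * pnorm p x)"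
proof -
  define C where "C = log 2 (real r) powr (1 / p)"
  have C: "1 \<le> C"
    unfolding C_def using log_r_ge_1 p by (intro ge_one_powr_ge_zero) auto
  have r_pos: "0 < r" using r by simp
  \<comment> \<open>The tolerance is divided by \<open>C\<close> because perturbations of the norm
    get multiplied by \<open>C\<close>.\<close>
  define \<delta> where "\<delta> = 1 / (10000 * C)"
  have \<delta>: "0 < \<delta>" "\<delta> \<le> 1 / 10000" "C * \<delta> = 1 / 10000"
    using C by (auto simp: \<delta>_def divide_simps)
  obtain u v where uv: "\<And>m. u m \<in> X" "\<And>m. finite {i. v m i \<noteq> 0}"
    "\<And>m n i. m \<noteq> n \<Longrightarrow> v m i = 0 \<or> v n i = 0"
    "\<And>m. flat (v m)" "\<And>m. 1 \<le> mass (v m)"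
    "\<And>m. pnorm p (\<lambda>i. u m i - v m i) \<le> \<delta> / 2 ^ Suc m"
    using almost_flat_blocks[OF X \<delta>(1)] by blast
  have u_lp: "u m \<in> lp p" for m
    using closed_subspace_lpD(1)[OF X(1)] uv(1) .
  define V where "V = finite_span u"
  have "V \<subseteq> X"
    unfolding V_def finite_span_def by clarify (rule closed_subspace_sum[OF X(1) uv(1)])
  then have V: "V \<subseteq> X" "V \<subseteq> lp p"
    using closed_subspace_lpD(1)[OF X(1)] by blast+
  define Y where "Y = lp_closure p V"
  note comb = block_combination[OF u_lp uv(2-5) \<delta>(1) uv(6)]
  have bounds: "pnorm p y / 2000 \<le> C * tnorm q r y \<and> C * tnorm q r y \<le> 60 * q * pnorm p y" if "y \<in> V" for y
  proof -
    obtain t and T :: nat where y: "y = (\<lambda>i. \<Sum>m<T. t m * u m i)"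
      using \<open>y \<in> V\<close> unfolding V_def finite_span_def by blast
    define z where "z = (\<lambda>i. \<Sum>m<T. t m * v m i)"
    have z: "spread z" "finite {i. z i \<noteq> 0}" "y \<in> lp p" "pnorm p (\<lambda>i. y i - z i) \<le> \<delta> * pnorm p z"
      using comb(1,2,3,5)[where t = t and T = T] unfolding z_def y by blast+
    have z_lp: "z \<in> lp p" by (rule lp_finite_support[OF z(2)])
    define n where "n = pnorm p z"
    define d where "d = pnorm p (\<lambda>i. y i - z i)"
    have n: "0 \<le> n" by (simp add: n_def pnorm_nonneg)
    have d: "d \<le> \<delta> * n" using z(4) by (simp add: d_def n_def)
    also have "\<dots> \<le> 1 / 10000 * n"
      using \<delta> n by (intro mult_right_mono)
    finally have d': "d \<le> n / 10000" by simp
    have "C * d \<le> C * (\<delta> * n)"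
      using d C by (intro mult_left_mono) auto
    also have "\<dots> = n / 10000"
      using \<delta>(3) by (simp add: mult.assoc[symmetric])
    finally have Cd: "C * d \<le> n / 10000" .
    have y1: "pnorm p y \<le> n + d"
      using pnorm_triangle_diff[of p y z] p z(3) z_lp by (simp add: n_def d_def)
    have y2: "n \<le> pnorm p y + d"
      using pnorm_triangle_diff[of p z y] p z(3) z_lp
      by (simp add: n_def d_def pnorm_minus_commute[of p z])
    have "tnorm q r y \<le> tnorm q r z + d" "tnorm q r z \<le> tnorm q r y + d"
      using tnorm_perturb[OF p q pq r_pos z(3) z_lp] tnorm_perturb[OF p q pq r_pos z_lp z(3)]
      by (auto simp: d_def pnorm_minus_commute[of p z])
    then have "C * tnorm q r y \<le> C * (tnorm q r z + d)" "C * tnorm q r z \<le> C * (tnorm q r y + d)"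
      using C by (auto intro: mult_left_mono)
    then have t: "C * tnorm q r y \<le> C * tnorm q r z + C * d" "C * tnorm q r z \<le> C * tnorm q r y + C * d"
      by (simp_all add: distrib_left)
    have tz: "n / 1536 \<le> C * tnorm q r z" "C * tnorm q r z \<le> 26 * q * n"
      using tnorm_spread[OF z(1,2)] by (auto simp: C_def n_def)
    \<comment> \<open>\<open>1 / 1536 - 1 / 10000\<close> exceeds
      \<open>(1 + 1 / 10000) / 2000\<close>.\<close>
    have "pnorm p y / 2000 \<le> C * tnorm q r y"
      using t(2) tz(1) Cd y1 d' n by linarith
    moreover have "C * tnorm q r y \<le> 60 * q * pnorm p y"
    proof -
      have "n \<le> 2 * pnorm p y"
        using y2 d' n by linarith
      \<comment> \<open>\<open>26 * q * n\<close> and the perturbation together stay below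
        \<open>27 * q * n\<close>, and \<open>2 * 27 \<le> 60\<close>.\<close>
      then have "27 * q * n \<le> 27 * q * (2 * pnorm p y)"
        using q by (intro mult_left_mono) auto
      moreover have "n \<le> q * n" "0 \<le> q * pnorm p y"
        using q n pnorm_nonneg[of p y] by (auto simp: mult_le_cancel_right1)
      ultimately show ?thesis
        using t(1) tz(2) Cd n by linarith
    qed
    ultimately show ?thesis ..
  qed
  have "4 powr (-6) * pnorm p x \<le> C * tnorm q r x \<and> C * tnorm q r x \<le> 3 * 4 ^ 7 * (p + q) * pnorm p x"
    if x: "x \<in> Y" for x
  proof -
    have x_lp: "x \<in> lp p" using lp_closureD(1) x by (auto simp: Y_def)
    \<comment> \<open>For fixed \<open>x\<close> the error is a fixed multiple of
      \<open>\<epsilon>\<close>, so the constants \<open>1 / 2000\<close> and \<open>60 * q\<close>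
      persist as \<open>\<epsilon>\<close> tends to 0.\<close>
    have approx: "pnorm p x / 2000 \<le> C * tnorm q r x + (C + 1) * \<epsilon> \<and>
        C * tnorm q r x \<le> 60 * q * pnorm p x + (C + 60 * q) * \<epsilon>" if \<epsilon>: "0 < \<epsilon>" for \<epsilon>
    proof -
      obtain y where y: "y \<in> V" "pnorm p (\<lambda>i. x i - y i) < \<epsilon>"
        using lp_closureD(2)[of x p V \<epsilon>] x \<epsilon> by (auto simp: Y_def)
      have y_lp: "y \<in> lp p" using y V by blast
      have y1: "pnorm p x \<le> pnorm p y + \<epsilon>" "pnorm p y \<le> pnorm p x + \<epsilon>"
        using pnorm_triangle_diff[of p x y] pnorm_triangle_diff[of p y x] p x_lp y_lp y
        by (auto simp: pnorm_minus_commute[of p y])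
      have "tnorm q r x \<le> tnorm q r y + \<epsilon>" "tnorm q r y \<le> tnorm q r x + \<epsilon>"
        using tnorm_perturb[OF p q pq r_pos x_lp y_lp] tnorm_perturb[OF p q pq r_pos y_lp x_lp] y
        by (auto simp: pnorm_minus_commute[of p y])
      then have "C * tnorm q r x \<le> C * (tnorm q r y + \<epsilon>)" "C * tnorm q r y \<le> C * (tnorm q r x + \<epsilon>)"
        using C by (auto intro: mult_left_mono)
      then have t: "C * tnorm q r x \<le> C * tnorm q r y + C * \<epsilon>" "C * tnorm q r y \<le> C * tnorm q r x + C * \<epsilon>"
        by (simp_all add: distrib_left)
      have "60 * q * pnorm p y \<le> 60 * q * (pnorm p x + \<epsilon>)"
        using y1 q by (intro mult_left_mono) auto
      then show ?thesis
        using t bounds[OF y(1)] y1 \<epsilon> by (simp add: distrib_left distrib_right)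
    qed
    have lim: "a \<le> b" if "\<And>\<epsilon>. 0 < \<epsilon> \<Longrightarrow> a \<le> b + K * \<epsilon>" "0 < K" for a b K :: real
    proof (rule field_le_epsilon)
      fix e :: real assume "0 < e"
      then show "a \<le> b + e"
        using that(1)[of "e / K"] that(2) by simp
    qed
    have lower: "pnorm p x / 2000 \<le> C * tnorm q r x"
    proof (rule lim)
      show "pnorm p x / 2000 \<le> C * tnorm q r x + (C + 1) * \<epsilon>" if "0 < \<epsilon>" for \<epsilon>
        using approx[OF that] by (rule conjunct1)
    qed (use C in simp)
    have upper: "C * tnorm q r x \<le> 60 * q * pnorm p x"
    proof (rule lim)
      show "C * tnorm q r x \<le> 60 * q * pnorm p x + (C + 60 * q) * \<epsilon>" if "0 < \<epsilon>" for \<epsilon>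
        using approx[OF that] by (rule conjunct2)
    qed (use C q in simp)
    have eq: "(4::real) powr (-6) = 1 / 4096"
      by (simp add: powr_minus_divide powr_numeral)
    have "4 powr (-6) * pnorm p x \<le> C * tnorm q r x"
      unfolding eq using lower pnorm_nonneg[of p x] by linarith
    moreover have "60 * q * pnorm p x \<le> 3 * 4 ^ 7 * (p + q) * pnorm p x"
      using p q by (intro mult_right_mono) (auto simp: pnorm_nonneg)
    ultimately show ?thesis
      using upper by linarith
  qed
  moreover have "infinite_dim Y"
    unfolding infinite_dim_def
  proof (intro allI exI conjI impI)
    fix n m :: nat
    have "u m = (\<lambda>i. \<Sum>j<Suc m. (if j = m then 1 else 0) * u j i)"
      by (simp add: fun_eq_iff)
    also have "\<dots> \<in> V"
      unfolding V_def by (rule finite_spanI)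
    finally have "u m \<in> V" .
    then show "u m \<in> Y"
      using lp_closure_superset[OF V(2)] by (auto simp: Y_def)
  next
    fix n
    show "lin_indep_fin n u"
      unfolding lin_indep_fin_def
    proof (intro allI impI)
      fix c m assume c: "\<forall>j. (\<Sum>i<n. c i * u i j) = 0" and m: "m < n"
      define z where "z = (\<lambda>i. \<Sum>m<n. c m * v m i)"
      \<comment> \<open>If a combination of the \<open>u m\<close> vanishes, the perturbation error
        is \<open>- z\<close> itself. The norm of \<open>z\<close> is then at most
        \<open>\<delta> < 1\<close> times itself, hence zero, and it bounds all
        coefficients.\<close>
      have "pnorm p (\<lambda>i. 0 - z i) \<le> \<delta> * pnorm p z"
        using comb(5)[where t = c and T = n] c by (simp add: z_def)
      moreover have "pnorm p (\<lambda>i. 0 - z i) = pnorm p z"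
        by (simp add: pnorm_def)
      moreover have "\<delta> * pnorm p z \<le> 1 / 10000 * pnorm p z"
        using \<delta> by (intro mult_right_mono pnorm_nonneg)
      ultimately have "pnorm p z \<le> 0"
        using pnorm_nonneg[of p z] by linarith
      then show "c m = 0"
        using comb(4)[where t = c and T = n and m = m] m by (simp add: z_def)
    qed
  qed
  moreover have "closed_subspace_lp p Y"
    unfolding Y_def using p V(2) finite_span_zero finite_span_add finite_span_scale
    by (intro closed_subspace_lp_closure) (auto simp: V_def)
  moreover have "Y \<subseteq> X"
    unfolding Y_def by (rule lp_closure_subset[OF X(1) V(1)])
  ultimately show ?thesis
    unfolding C_def by blast
qed

end

theorem theorem4p1:
  fixes p q :: real and r :: nat and X :: "(nat \<Rightarrow> real) set"
  assumes "1 < p" and "1 < q" and "1 / p + 1 / q = 1" and "1 < r"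
    and "closed_subspace_lp p X" and "infinite_dim X"
  shows "\<exists>Y. Y \<subseteq> X \<and> closed_subspace_lp p Y \<and> infinite_dim Y \<and>
           (\<forall>x\<in>Y. 4 powr (-6) * pnorm p x \<le> (log 2 (real r)) powr (1 / p) * tnorm q r x
                 \<and> (log 2 (real r)) powr (1 / p) * tnorm q r x \<le> 3 * 4 ^ 7 * (p + q) * pnorm p x)"
proof -
  interpret conjugate_exponents p q r
    using assms by unfold_locales
  show ?thesis
    using assms(5,6) by (rule tnorm_equivalent_subspace)
qed

end
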